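(* Let $\rho_3=2\sqrt[3]{4}$. If $H$ is a connected $3$-uniform hypergraph with $\rho(H)=\rho_3$, then $H$ is isomorphic to one of the following hypergraphs: (1) $C^{(3)}_n$ for some $n\geq 3$; (2) $\tilde D^{(3)}_n$ for some $n\geq 5$; (3) $\tilde B^{(3)}_n$ for some $n\geq 8$; (4) $\widetilde{BD}^{(3)}_n$ for some $n\geq 6$; (5) one of the twelve exceptional hypergraphs $C^{(3)}_2$, $S^{(3)}_4$, $\tilde E^{(3)}_6$, $\tilde E^{(3)}_7$, $\tilde E^{(3)}_8$, $F^{(3)}_{2,3,4}$, $F^{(3)}_{2,2,7}$, $F^{(3)}_{1,5,6}$, $F^{(3)}_{1,4,8}$, $F^{(3)}_{1,3,14}$, $G^{(3)}_{1,1:0:1,4}$, $G^{(3)}_{1,1:6:1,3}$.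
   Context: An $r$-uniform hypergraph $H=(V,E)$ has a finite vertex set $V$ and edge set $E\subseteq\binom{V}{r}$. The degree of a vertex is the number of edges containing it; a leaf vertex is a vertex of degree $1$. A walk is a sequence $v_0e_1v_1\cdots e_lv_l$ with $v_{i-1},v_i\in e_i$; $H$ is connected if any two vertices are joined by a walk. The spectral radius is $\rho(H)=\max_{x\in\mathbb{R}^{V}_{\geq 0},x\neq 0} \frac{r!\sum_{e\in E}\prod_{v\in e}x_v}{\sum_{v\in V}x_v^r}$. Hypergraphs are considered up to isomorphism. Special $3$-uniform hypergraphs. A path of length $k\geq1$ is a sequence of edges $e_1,\dots,e_k$ with $|e_i\cap e_{i+1}|=1$ and $e_i\cap e_j=\emptyset$ for $|i-j|\geq 2$. Attaching a pendant path of length $k\geq 1$ at a vertex $v$ of a hypergraph means adding new edges $e_1,\dots,e_k$ forming a path of length $k$ such that $v\in e_1$, $v\notin e_j$ for $j\geq 2$, and all other vertices of the $e_i$ are new; length $0$ means adding nothing. A pendant edge is a pendant path of length $1$. - $A^{(3)}_n$: a path of length $n$. - $C^{(3)}_n$ ($n\geq 3$): distinct vertices $v_1,\dots,v_n,w_1,\dots,w_n$ with edges $\{v_i,v_{i+1},w_i\}$, indices mod $n$. $C^{(3)}_2$: two edges sharing exactly two vertices. $S^{(3)}_4$: four edges any two of which meet exactly in one common vertex $v$. - $E^{(3)}_{i,j,k}$: a vertex $v$ with pendant paths of lengths $i,j,k\geq1$ attached at $v$. Aliases: $\tilde E^{(3)}_6=E^{(3)}_{2,2,2}$, $\tilde E^{(3)}_7=E^{(3)}_{1,3,3}$,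 $\tilde E^{(3)}_8=E^{(3)}_{1,2,5}$. - $F^{(3)}_{i,j,k}$: an edge $\{a,b,c\}$ with pendant paths of lengths $i,j,k$ attached at $a,b,c$ respectively. - $G^{(3)}_{i,j:k:l,m}$ ($k\geq 0$): a path with edges $e_0,e_1,\dots,e_{k+1}$; let $u_1,u_2$ be the two vertices of $e_0$ not in $e_1$ and $u_3,u_4$ the two vertices of $e_{k+1}$ not in $e_k$; attach pendant paths of lengths $i,j,l,m$ at $u_1,u_2,u_3,u_4$ respectively. Alias: $\tilde B^{(3)}_n=G^{(3)}_{1,2:(n-8):1,2}$ ($n\geq 8$). - $\tilde D^{(3)}_n$ ($n\geq5$): a path $e_1,\dots,e_{n-2}$ with a pendant edge attached at the vertex of $e_1\cap e_2$ and a pendant edge attached at the vertex of $e_{n-3}\cap e_{n-2}$. - $\widetilde{BD}^{(3)}_n$ ($n\geq 6$): a path $e_1,\dots,e_{n-2}$ with a pendant edge attached at the vertex of $e_1\cap e_2$ and a pendant edge attached at the unique vertex of $e_{n-4}$ lying in no other edge of the path. In every case the subscript $n$ is the number of edges. *)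

theory Defs
  imports "HOL-Analysis.Analysis"
begin

section \<open>Uniform hypergraphs\<close>

type_synonym 'a hypergraph = "'a set \<times> 'a set set"

abbreviation verts :: "'a hypergraph \<Rightarrow> 'a set" where
  "verts \<equiv> fst"

abbreviation edges :: "'a hypergraph \<Rightarrow> 'a set set" where
  "edges \<equiv> snd"

definition uniform_hypergraph :: "nat \<Rightarrow> 'a hypergraph \<Rightarrow> bool" where
  "uniform_hypergraph r H \<longleftrightarrow>
     finite (verts H) \<and> (\<forall>e\<in>edges H. e \<subseteq> verts H \<and> card e = r)"

text \<open>The walk \<open>v\<^sub>0 e\<^sub>1 v\<^sub>1 \<dots> e\<^sub>l v\<^sub>l\<close> is given by its list of vertices \<open>vs\<close>
  and its list of edges \<open>es\<close>; the walk of length \<open>0\<close> at a vertex is allowed.\<close>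

definition walk :: "'a hypergraph \<Rightarrow> 'a list \<Rightarrow> 'a set list \<Rightarrow> bool" where
  "walk H vs es \<longleftrightarrow>
     length vs = Suc (length es) \<and> set vs \<subseteq> verts H \<and> set es \<subseteq> edges H \<and>
     (\<forall>i<length es. vs ! i \<in> es ! i \<and> vs ! Suc i \<in> es ! i)"

definition connected_hypergraph :: "'a hypergraph \<Rightarrow> bool" where
  "connected_hypergraph H \<longleftrightarrow>
     (\<forall>u\<in>verts H. \<forall>v\<in>verts H. \<exists>vs es. walk H vs es \<and> hd vs = u \<and> last vs = v)"

definition hypergraph_iso :: "'a hypergraph \<Rightarrow> 'b hypergraph \<Rightarrow> bool" where
  "hypergraph_iso H K \<longleftrightarrow>
     (\<exists>f. bij_betw f (verts H) (verts K) \<and> edges K = (\<lambda>e. f ` e) ` edges H)"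


section \<open>The spectral radius\<close>

definition rayleigh_quotient :: "nat \<Rightarrow> 'a hypergraph \<Rightarrow> ('a \<Rightarrow> real) \<Rightarrow> real" where
  "rayleigh_quotient r H x =
     (fact r * (\<Sum>e\<in>edges H. \<Prod>v\<in>e. x v)) / (\<Sum>v\<in>verts H. x v ^ r)"

text \<open>For a nonempty vertex set the supremum is a maximum, see
  \<open>spectral_radius_is_max\<close> below. Over the empty vertex set there is no nonzero
  vector, so the value \<open>0\<close> is fixed there by convention.\<close>

definition spectral_radius :: "nat \<Rightarrow> 'a hypergraph \<Rightarrow> real" where
  "spectral_radius r H =
     (if verts H = {} then 0
      else Sup {rayleigh_quotient r H x | x.
                  (\<forall>v\<in>verts H. x v \<ge> 0) \<and> (\<exists>v\<in>verts H. x v \<noteq> 0)})"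

lemma rayleigh_quotient_cong:
  assumes "uniform_hypergraph r H" and "\<And>v. v \<in> verts H \<Longrightarrow> x v = y v"
  shows "rayleigh_quotient r H x = rayleigh_quotient r H y"
proof -
  have "(\<Prod>v\<in>e. x v) = (\<Prod>v\<in>e. y v)" if "e \<in> edges H" for e
    using assms that by (intro prod.cong) (auto simp: uniform_hypergraph_def)
  then show ?thesis
    using assms(2) by (simp add: rayleigh_quotient_def)
qed

lemma rayleigh_quotient_scale:
  assumes "uniform_hypergraph r H" and "c \<noteq> 0"
  shows "rayleigh_quotient r H (\<lambda>v. c * x v) = rayleigh_quotient r H x"
proof -
  have "(\<Prod>v\<in>e. c * x v) = c ^ r * (\<Prod>v\<in>e. x v)" if "e \<in> edges H" for e
    using assms(1) that by (auto simp: uniform_hypergraph_def prod.distrib)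
  then have "(\<Sum>e\<in>edges H. \<Prod>v\<in>e. c * x v) = c ^ r * (\<Sum>e\<in>edges H. \<Prod>v\<in>e. x v)"
    by (simp add: sum_distrib_left)
  moreover have "(\<Sum>v\<in>verts H. (c * x v) ^ r) = c ^ r * (\<Sum>v\<in>verts H. x v ^ r)"
    by (simp add: sum_distrib_left power_mult_distrib)
  ultimately show ?thesis
    using assms(2) by (simp add: rayleigh_quotient_def)
qed

lemma spectral_radius_is_max:
  assumes H: "uniform_hypergraph r H" and V: "verts H \<noteq> {}"
  shows "\<exists>x. (\<forall>v\<in>verts H. x v \<ge> 0) \<and> (\<exists>v\<in>verts H. x v \<noteq> 0) \<and>
           rayleigh_quotient r H x = spectral_radius r H"
    and "(\<forall>v\<in>verts H. y v \<ge> 0) \<Longrightarrow> (\<exists>v\<in>verts H. y v \<noteq> 0) \<Longrightarrow>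
           rayleigh_quotient r H y \<le> spectral_radius r H"
proof -
  let ?V = "verts H"
  let ?f = "rayleigh_quotient r H"
  define X where "X = {x. (\<forall>v\<in>?V. x v \<ge> (0::real)) \<and> (\<exists>v\<in>?V. x v \<noteq> 0)}"
  define B where "B = PiE UNIV (\<lambda>v. if v \<in> ?V then {0..1} else {0::real})"
  define K where "K = B \<inter> {x. (\<Sum>v\<in>?V. x v) = 1}"
  have fin: "finite ?V"
    using H by (simp add: uniform_hypergraph_def)
  have "compact B"
    unfolding B_def compactin_euclidean_iff[symmetric] euclidean_product_topology[symmetric]
    by (subst compactin_PiE) auto
  moreover have "closed {x::'a \<Rightarrow> real. (\<Sum>v\<in>?V. x v) = 1}"
    by (intro closed_Collect_eq continuous_intros continuous_on_product_then_coordinatewise)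
  ultimately have compact: "compact K"
    unfolding K_def by (rule compact_Int_closed)
  have KX: "K \<subseteq> X"
  proof
    fix x assume "x \<in> K"
    then have x: "x v \<in> (if v \<in> ?V then {0..1} else {0})" and s: "(\<Sum>v\<in>?V. x v) = 1" for v
      by (auto simp: K_def B_def PiE_def Pi_def)
    have "\<exists>v\<in>?V. x v \<noteq> 0"
      using s by (metis sum.neutral zero_neq_one)
    moreover have "\<forall>v\<in>?V. x v \<ge> 0"
      using x by (metis atLeastAtMost_iff)
    ultimately show "x \<in> X"
      by (simp add: X_def)
  qed
  have pos: "\<exists>w\<in>?V. x w > 0" and nonneg: "\<forall>v\<in>?V. x v \<ge> 0" if "x \<in> X" for x
    using that unfolding X_def by (simp_all add: order_less_le)
  have norm: "\<exists>z\<in>K. ?f z = ?f x" if x: "x \<in> X" for x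
  proof -
    define s where "s = (\<Sum>v\<in>?V. x v)"
    define z where "z v = (if v \<in> ?V then x v / s else 0)" for v
    obtain w where w: "w \<in> ?V" "x w > 0" and nn: "\<forall>v\<in>?V. x v \<ge> 0"
      using pos[OF x] nonneg[OF x] by blast
    have s: "s > 0"
      unfolding s_def using fin w nn by (intro sum_pos2) auto
    have le: "x v \<le> s" if "v \<in> ?V" for v
      unfolding s_def using fin nn that by (intro member_le_sum) auto
    have "(\<Sum>v\<in>?V. z v) = s / s"
      by (simp add: z_def s_def flip: sum_divide_distrib)
    then have "z \<in> K"
      using s le nn by (auto simp: K_def B_def z_def divide_le_eq)
    moreover have "?f z = ?f (\<lambda>v. (1 / s) * x v)"
      by (rule rayleigh_quotient_cong[OF H]) (simp add: z_def)
    ultimately show ?thesis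
      using rayleigh_quotient_scale[OF H, of "1 / s" x] s by auto
  qed
  have "(\<Sum>v\<in>?V. x v ^ r) \<noteq> 0" if x: "x \<in> X" for x
  proof -
    obtain w where "w \<in> ?V" "x w > 0" "\<forall>v\<in>?V. x v \<ge> 0"
      using pos[OF x] nonneg[OF x] by blast
    then have "(\<Sum>v\<in>?V. x v ^ r) > 0"
      using fin by (intro sum_pos2[of _ w]) auto
    then show ?thesis by simp
  qed
  then have "continuous_on K ?f"
    unfolding rayleigh_quotient_def using KX
    by (intro continuous_intros continuous_on_product_then_coordinatewise) auto
  moreover have "K \<noteq> {}"
  proof -
    have "(\<lambda>v. 1) \<in> X" using V by (auto simp: X_def)
    then show ?thesis using norm by blast
  qed
  ultimately obtain x where x: "x \<in> K" "\<forall>z\<in>K. ?f z \<le> ?f x"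
    using continuous_attains_sup[OF compact] by blast
  have max: "?f z \<le> ?f x" if "z \<in> X" for z
    using norm[OF that] x(2) by force
  have "Sup (?f ` X) = ?f x"
    using x(1) KX max by (intro cSup_eq_maximum) auto
  moreover have "{?f x | x. (\<forall>v\<in>?V. x v \<ge> 0) \<and> (\<exists>v\<in>?V. x v \<noteq> 0)} = ?f ` X"
    by (auto simp: X_def)
  ultimately have rho: "spectral_radius r H = ?f x"
    using V by (simp add: spectral_radius_def)
  show "\<exists>x. (\<forall>v\<in>?V. x v \<ge> 0) \<and> (\<exists>v\<in>?V. x v \<noteq> 0) \<and> ?f x = spectral_radius r H"
    using subsetD[OF KX x(1)] rho unfolding X_def by (intro exI[of _ x]) simp
  show "?f y \<le> spectral_radius r H" if "\<forall>v\<in>?V. y v \<ge> 0" "\<exists>v\<in>?V. y v \<noteq> 0"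
    using max[of y] that rho by (simp add: X_def)
qed


section \<open>Paths and attached pendant paths\<close>

text \<open>The special hypergraphs are given by representatives on natural numbers.
  The path with \<open>k\<close> edges has the vertices \<open>0, \<dots>, 2 * k\<close>; its consecutive edges number
  \<open>i\<close> and \<open>Suc i\<close>, counted from \<open>0\<close>, meet in the vertex \<open>2 * i + 2\<close>.\<close>

definition path_edge :: "nat \<Rightarrow> nat set" where
  "path_edge i = {2 * i, 2 * i + 1, 2 * i + 2}"

definition path_graph :: "nat \<Rightarrow> nat hypergraph" where
  "path_graph k = ({0..2 * k}, path_edge ` {..<k})"

text \<open>A pendant path at \<open>v\<close> uses the fresh vertices \<open>m, m + 1, \<dots>\<close> in pairs: its edge
  number \<open>i\<close> consists of \<open>m + 2 * i\<close>, \<open>m + 2 * i + 1\<close> and either \<open>v\<close> (if \<open>i = 0\<close>) or the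
  last vertex of the preceding edge.\<close>

definition pendant_edge :: "nat \<Rightarrow> nat \<Rightarrow> nat \<Rightarrow> nat set" where
  "pendant_edge m v i = {if i = 0 then v else m + 2 * i - 1, m + 2 * i, m + 2 * i + 1}"

definition attach :: "nat \<Rightarrow> nat \<Rightarrow> nat hypergraph \<Rightarrow> nat hypergraph" where
  "attach v k H =
     (let m = Suc (Max (verts H))
      in (verts H \<union> {m..<m + 2 * k}, edges H \<union> pendant_edge m v ` {..<k}))"

definition is_hyperpath :: "'a set list \<Rightarrow> bool" where
  "is_hyperpath es \<longleftrightarrow>
     es \<noteq> [] \<and> (\<forall>e\<in>set es. card e = 3) \<and>
     (\<forall>i. Suc i < length es \<longrightarrow> card (es ! i \<inter> es ! Suc i) = 1) \<and>
     (\<forall>i j. i < length es \<longrightarrow> j < length es \<longrightarrow> i + 2 \<le> j \<longrightarrow> es ! i \<inter> es ! j = {})"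

lemma is_hyperpath_path_graph:
  assumes "k \<ge> 1"
  shows "is_hyperpath (map path_edge [0..<k])"
    and "edges (path_graph k) = set (map path_edge [0..<k])"
    and "verts (path_graph k) = \<Union> (edges (path_graph k))"
proof -
  have "path_edge i \<inter> path_edge (Suc i) = {2 * i + 2}" for i
    by (auto simp: path_edge_def)
  then show "is_hyperpath (map path_edge [0..<k])"
    using assms by (auto simp: is_hyperpath_def path_edge_def)
  show "edges (path_graph k) = set (map path_edge [0..<k])"
    by (auto simp: path_graph_def)
  have "x \<in> \<Union> (edges (path_graph k))" if "x \<le> 2 * k" for x
  proof (cases "x = 0")
    case True
    then show ?thesis using assms by (force simp: path_graph_def path_edge_def)
  next
    case False
    then have "x \<in> path_edge ((x - 1) div 2)" "(x - 1) div 2 < k"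
      using that by (auto simp: path_edge_def)
    then show ?thesis by (auto simp: path_graph_def)
  qed
  then show "verts (path_graph k) = \<Union> (edges (path_graph k))"
    by (auto simp: path_graph_def path_edge_def)
qed

lemma attach_0 [simp]: "attach v 0 H = H"
  by (simp add: attach_def)

lemma attach_is_pendant_path:
  assumes "finite (verts H)" and "v \<in> verts H" and "k \<ge> 1"
  obtains es where "length es = k" and "is_hyperpath es"
    and "v \<in> es ! 0" and "\<And>j. 1 \<le> j \<Longrightarrow> j < k \<Longrightarrow> v \<notin> es ! j"
    and "\<Union> (set es) \<inter> verts H = {v}"
    and "edges (attach v k H) = edges H \<union> set es"
    and "verts (attach v k H) = verts H \<union> \<Union> (set es)"
proof -
  define m where "m = Suc (Max (verts H))"
  define p where "p = pendant_edge m v"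
  have m: "x < m" if "x \<in> verts H" for x
    using assms(1) that by (simp add: m_def le_imp_less_Suc)
  have vm: "v < m"
    using m assms(2) by simp
  have "card (p i) = 3" for i
  proof -
    have "(if i = 0 then v else m + 2 * i - 1) < m + 2 * i"
      using vm by auto
    then show ?thesis
      unfolding p_def pendant_edge_def by simp
  qed
  moreover have "p i \<inter> p (Suc i) = {m + 2 * i + 1}" for i
    using vm by (auto simp: p_def pendant_edge_def)
  moreover have "p i \<inter> p j = {}" if "i + 2 \<le> j" for i j
    using vm that by (auto simp: p_def pendant_edge_def)
  ultimately have path: "is_hyperpath (map p [0..<k])"
    using assms(3) by (auto simp: is_hyperpath_def)
  have un: "\<Union> (p ` {..<k}) = insert v {m..<m + 2 * k}"
  proof
    show "\<Union> (p ` {..<k}) \<subseteq> insert v {m..<m + 2 * k}"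
      by (auto simp: p_def pendant_edge_def)
    have "x \<in> \<Union> (p ` {..<k})" if "m \<le> x" "x < m + 2 * k" for x
    proof -
      have "x = m + 2 * ((x - m) div 2) \<or> x = m + 2 * ((x - m) div 2) + 1"
        using that by presburger
      then have "x \<in> p ((x - m) div 2)"
        by (auto simp: p_def pendant_edge_def)
      moreover have "(x - m) div 2 < k"
        using that by auto
      ultimately show ?thesis by blast
    qed
    moreover have "v \<in> p 0"
      by (simp add: p_def pendant_edge_def)
    ultimately show "insert v {m..<m + 2 * k} \<subseteq> \<Union> (p ` {..<k})"
      using assms(3) by auto
  qed
  show thesis
  proof (rule that[of "map p [0..<k]"])
    show "v \<in> map p [0..<k] ! 0"
      using assms(3) by (simp add: p_def pendant_edge_def)
    show "v \<notin> map p [0..<k] ! j" if "1 \<le> j" "j < k" for j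
      using that vm by (auto simp: p_def pendant_edge_def)
    have s: "set (map p [0..<k]) = p ` {..<k}"
      by auto
    show "\<Union> (set (map p [0..<k])) \<inter> verts H = {v}"
      unfolding s un using m assms(2) by force
    show "edges (attach v k H) = edges H \<union> set (map p [0..<k])"
      unfolding s by (simp add: attach_def p_def m_def Let_def)
    show "verts (attach v k H) = verts H \<union> \<Union> (set (map p [0..<k]))"
      unfolding s un using assms(2) by (auto simp: attach_def m_def Let_def)
  qed (use path in auto)
qed


section \<open>The special 3-uniform hypergraphs\<close>

text \<open>In \<open>C_graph n\<close> the vertices \<open>0, \<dots>, n - 1\<close> are \<open>v\<^sub>1, \<dots>, v\<^sub>n\<close> and the vertices
  \<open>n, \<dots>, 2 * n - 1\<close> are \<open>w\<^sub>1, \<dots>, w\<^sub>n\<close>; meant for \<open>n \<ge> 3\<close>.\<close>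

definition C_graph :: "nat \<Rightarrow> nat hypergraph" where
  "C_graph n = ({..<2 * n}, (\<lambda>i. {i, Suc i mod n, n + i}) ` {..<n})"

definition C2_graph :: "nat hypergraph" where
  "C2_graph = ({0, 1, 2, 3}, {{0, 1, 2}, {0, 1, 3}})"

definition S4_graph :: "nat hypergraph" where
  "S4_graph = ({0..8}, {{0, 1, 2}, {0, 3, 4}, {0, 5, 6}, {0, 7, 8}})"

definition E_graph :: "nat \<Rightarrow> nat \<Rightarrow> nat \<Rightarrow> nat hypergraph" where
  "E_graph i j k = attach 0 k (attach 0 j (attach 0 i ({0}, {})))"

definition F_graph :: "nat \<Rightarrow> nat \<Rightarrow> nat \<Rightarrow> nat hypergraph" where
  "F_graph i j k = attach 2 k (attach 1 j (attach 0 i ({0, 1, 2}, {{0, 1, 2}})))"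

text \<open>The path \<open>e\<^sub>0, \<dots>, e\<^bsub>k+1\<^esub>\<close> has \<open>k + 2\<close> edges; the vertices \<open>0, 1\<close> of \<open>e\<^sub>0\<close> are not
  in \<open>e\<^sub>1\<close>, and the vertices \<open>2 * k + 3, 2 * k + 4\<close> of \<open>e\<^bsub>k+1\<^esub>\<close> are not in \<open>e\<^sub>k\<close>.\<close>

definition G_graph :: "nat \<Rightarrow> nat \<Rightarrow> nat \<Rightarrow> nat \<Rightarrow> nat \<Rightarrow> nat hypergraph" where
  "G_graph i j k l m =
     attach (2 * k + 4) m (attach (2 * k + 3) l (attach 1 j (attach 0 i (path_graph (k + 2)))))"

definition B_tilde :: "nat \<Rightarrow> nat hypergraph" where
  "B_tilde n = G_graph 1 2 (n - 8) 1 2"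

text \<open>In the path \<open>e\<^sub>1, \<dots>, e\<^bsub>n-2\<^esub>\<close>, whose edges \<open>e\<^sub>i\<close> are \<open>path_edge (i - 1)\<close>, the vertex
  \<open>2\<close> is common to \<open>e\<^sub>1\<close> and \<open>e\<^sub>2\<close>, the vertex \<open>2 * (n - 3)\<close> is common to \<open>e\<^bsub>n-3\<^esub>\<close> and
  \<open>e\<^bsub>n-2\<^esub>\<close>, and \<open>2 * (n - 5) + 1\<close> is the vertex of \<open>e\<^bsub>n-4\<^esub>\<close> on no other edge of the path.
  The subtractions are those of natural numbers: \<open>D_tilde n\<close> is meant for \<open>n \<ge> 5\<close> and
  \<open>BD_tilde n\<close> for \<open>n \<ge> 6\<close>.\<close>

definition D_tilde :: "nat \<Rightarrow> nat hypergraph" where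
  "D_tilde n = attach (2 * (n - 3)) 1 (attach 2 1 (path_graph (n - 2)))"

definition BD_tilde :: "nat \<Rightarrow> nat hypergraph" where
  "BD_tilde n = attach (2 * (n - 5) + 1) 1 (attach 2 1 (path_graph (n - 2)))"

definition E6_tilde :: "nat hypergraph" where
  "E6_tilde = E_graph 2 2 2"

definition E7_tilde :: "nat hypergraph" where
  "E7_tilde = E_graph 1 3 3"

definition E8_tilde :: "nat hypergraph" where
  "E8_tilde = E_graph 1 2 5"

lemma D_tilde_attachment_vertices:
  assumes "n \<ge> 5"
  shows "path_edge 0 \<inter> path_edge 1 = {2}"
    and "path_edge (n - 4) \<inter> path_edge (n - 3) = {2 * (n - 3)}"
  using assms by (auto simp: path_edge_def)

lemma BD_tilde_attachment_vertex:
  assumes "n \<ge> 6"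
  shows "path_edge (n - 5) - (\<Union>i\<in>{..<n - 2} - {n - 5}. path_edge i) = {2 * (n - 5) + 1}"
proof -
  have "2 * (n - 5) \<in> path_edge (n - 6)" "2 * (n - 5) + 2 \<in> path_edge (n - 4)"
    using assms by (auto simp: path_edge_def)
  moreover have "n - 6 \<in> {..<n - 2} - {n - 5}" "n - 4 \<in> {..<n - 2} - {n - 5}"
    using assms by auto
  moreover have "2 * (n - 5) + 1 \<notin> path_edge i" if "i \<noteq> n - 5" for i
    using that by (simp add: path_edge_def)
  ultimately show ?thesis
    by (auto simp: path_edge_def[of "n - 5"])
qed

end

theory Submission
  imports Defs
begin

text \<open>A Perron vector \<open>x\<close> of \<open>H\<close> gives the weights \<open>B v e = 2 (\<Prod>u\<in>e. x u) / (\<rho> x v ^ 3)\<close>, which sum to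
  \<open>1\<close> around every vertex and multiply to \<open>2 ^ 3 / \<rho> ^ 3 = 1 / 4\<close> on every edge. These two conditions
  alone determine \<open>H\<close>. The weight of an edge at \<open>v\<close> is at least \<open>1 / 4\<close>, and below \<open>4 / 9\<close> it can
  only be one of the values \<open>k / (2 (k + 1))\<close> with \<open>k \<le> 7\<close>, in which case a pendant path of length
  \<open>k\<close> starts there. This leaves finitely many weight patterns around a vertex of degree at least \<open>3\<close>
  or an edge without leaf, and from such a place the weights along a path force how \<open>H\<close>
  continues. If there is no such place, then all weights are \<open>1 / 2\<close> or \<open>1\<close> and \<open>H\<close> is a cycle.

  An exploration of \<open>H\<close> yields a map from a special hypergraph to \<open>H\<close> that is bijective on the
  edges at each vertex, so all its fibres have the same size \<open>c\<close>. Since a hypertree has one more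
  vertex than twice its number of edges, \<open>c\<close> divides \<open>1\<close> and the map is an isomorphism.\<close>

section \<open>Weights from a Perron vector\<close>

text \<open>One map lies behind most of the numbers. Crossing an edge with a leaf turns the weight
  \<open>t\<close> into \<open>1 / (4 * t)\<close> at its other vertex, and passing to the only
  other edge there takes the complement: \<open>t\<close> becomes \<open>1 - 1 / (4 * t)\<close>.
  The only fixed point is \<open>1 / 2\<close>, a double one. At \<open>1 / 2\<close> a walk learns
  nothing about its length, which produces the infinite families; elsewhere the weight strictly
  decreases, so the weights at the two ends fix the length.

  The obstacle is that an exploration might run back into itself. No distinctness is proved along
  the way: only a local bijection is maintained, and the final count yields injectivity. Termination
  needs its own reasons, namely a descent in the weights for pendant paths, and finiteness with
  unique predecessors for walks.\<close>

text \<open>The only form in which connectedness is used: for the positivity of the Perron vector,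
  for the constancy of the fibre sizes, and for the exhaustion of \<open>H\<close> by a
  cycle.\<close>

lemma connected_hypergraph_closed:
  assumes "connected_hypergraph H" "A \<subseteq> verts H" "A \<noteq> {}"
    and cl: "\<And>e. e \<in> edges H \<Longrightarrow> e \<inter> A \<noteq> {} \<Longrightarrow> e \<inter> verts H \<subseteq> A"
  shows "A = verts H"
proof
  show "verts H \<subseteq> A"
  proof
    fix v assume v: "v \<in> verts H"
    obtain u where u: "u \<in> A" "u \<in> verts H" using assms(2,3) by blast
    then obtain vs es where w: "walk H vs es" "hd vs = u" "last vs = v"
      using assms(1) v unfolding connected_hypergraph_def by blast
    have l: "length vs = Suc (length es)" "set vs \<subseteq> verts H"
      using w(1) by (auto simp: walk_def)
    have "i \<le> length es \<Longrightarrow> vs ! i \<in> A" for i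
    proof (induction i)
      case 0
      then show ?case using w(2) u l by (metis hd_conv_nth length_0_conv nat.distinct(1))
    next
      case (Suc i)
      then have "vs ! i \<in> A" "vs ! i \<in> es ! i" "vs ! Suc i \<in> es ! i" "es ! i \<in> edges H"
        "vs ! Suc i \<in> verts H"
        using w(1) l by (auto simp: walk_def)
      then show ?case using cl[of "es ! i"] by blast
    qed
    moreover have "v = vs ! length es"
      using w(3) l by (metis diff_Suc_1 last_conv_nth length_0_conv nat.distinct(1))
    ultimately show "v \<in> A" by simp
  qed
qed (fact assms(2))

section \<open>Positivity and eigenvalue equation of a maximizing vector\<close>

locale perron_vector =
  fixes H :: "'a hypergraph" and x :: "'a \<Rightarrow> real" and r :: real
  assumes uniform: "uniform_hypergraph 3 H"
    and connected: "connected_hypergraph H"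
    and nonneg: "\<And>v. v \<in> verts H \<Longrightarrow> x v \<ge> 0"
    and nonzero: "\<exists>v\<in>verts H. x v \<noteq> 0"
    and eq: "rayleigh_quotient 3 H x = r"
    and le: "\<And>y. \<forall>v\<in>verts H. y v \<ge> 0 \<Longrightarrow> \<exists>v\<in>verts H. y v \<noteq> 0 \<Longrightarrow> rayleigh_quotient 3 H y \<le> r"
    and r_pos: "r > 0"
begin

lemma finite_verts: "finite (verts H)" and edge_sub: "e \<in> edges H \<Longrightarrow> e \<subseteq> verts H"
  and edge_card: "e \<in> edges H \<Longrightarrow> card e = 3"
  using uniform by (auto simp: uniform_hypergraph_def)

lemma finite_edge: "e \<in> edges H \<Longrightarrow> finite e"
  using edge_sub finite_verts finite_subset by blast

lemma finite_edges: "finite (edges H)"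
  using edge_sub finite_verts by (meson Pow_iff finite_Pow_iff finite_subset subsetI)

definition N where "N y = (\<Sum>e\<in>edges H. \<Prod>v\<in>e. y v)" for y :: "'a \<Rightarrow> real"
definition D where "D y = (\<Sum>v\<in>verts H. y v ^ 3)" for y :: "'a \<Rightarrow> real"

lemma D_pos:
  assumes "\<forall>v\<in>verts H. y v \<ge> 0" "\<exists>v\<in>verts H. y v \<noteq> 0"
  shows "D y > 0"
proof -
  obtain w where "w \<in> verts H" "y w > 0" using assms by force
  then show ?thesis unfolding D_def using finite_verts assms(1)
    by (intro sum_pos2[of _ w]) auto
qed

lemma rq: "rayleigh_quotient 3 H y = 6 * N y / D y"
  by (simp add: rayleigh_quotient_def N_def D_def fact_numeral)

lemma N_le:
  assumes "\<forall>v\<in>verts H. y v \<ge> 0" "\<exists>v\<in>verts H. y v \<noteq> 0"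
  shows "6 * N y \<le> r * D y"
  using le[OF assms] D_pos[OF assms] by (simp add: rq divide_le_eq)

lemma N_eq: "6 * N x = r * D x"
  using eq D_pos[of x] nonneg nonzero by (simp add: rq divide_eq_eq)

text \<open>If \<open>x\<close> vanished on a part of an edge but not on all of it, raising these
  zeros to \<open>\<epsilon>\<close> would raise the numerator by order \<open>\<epsilon>^2\<close>
  at least, there being at most two of them, and the denominator only by order
  \<open>\<epsilon>^3\<close>. The quotient would exceed its maximum.\<close>

lemma pos: "v \<in> verts H \<Longrightarrow> x v > 0"
proof -
  define P where "P = {v\<in>verts H. x v > 0}"
  have "P = verts H"
  proof (rule connected_hypergraph_closed[OF connected])
    show "P \<noteq> {}" using nonzero nonneg by (force simp: P_def)
    fix e assume e: "e \<in> edges H" "e \<inter> P \<noteq> {}"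
    show "e \<inter> verts H \<subseteq> P"
    proof (rule ccontr)
      assume "\<not> e \<inter> verts H \<subseteq> P"
      then have Z0: "e - P \<noteq> {}" by blast
      have fe: "finite e" using finite_edge e by blast
      define c where "c = (\<Prod>v\<in>e \<inter> P. x v)"
      have c: "c > 0" unfolding c_def by (rule prod_pos) (auto simp: P_def)
      \<comment> \<open>The bound \<open>c / r\<close> keeps the loss
        \<open>r * (2 * \<epsilon> ^ 3)\<close> below \<open>2 * c * \<epsilon> ^ 2\<close>, against
        a gain of at least \<open>6 * c * \<epsilon> ^ 2\<close>; the bound 1 makes the exponent 2
        the worst case.\<close>
      define \<epsilon> where "\<epsilon> = min 1 (c / r)"
      have \<epsilon>: "\<epsilon> > 0" "\<epsilon> \<le> 1" "r * \<epsilon> \<le> c"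
        using c r_pos by (auto simp: \<epsilon>_def min_def field_simps)
      define y where "y v = (if v \<in> e - P then \<epsilon> else x v)" for v
      have xy: "x v \<le> y v" if "v \<in> verts H" for v
        using that nonneg[OF that] \<epsilon> by (auto simp: y_def P_def)
      have z: "x v = 0" if "v \<in> e - P" for v
        using that nonneg[of v] edge_sub[OF e(1)] by (force simp: P_def)
      have card: "card (e - P) \<le> 2"
      proof -
        have "card (e - P) < card e" using e fe by (intro psubset_card_mono) auto
        then show ?thesis using edge_card e by simp
      qed
      have "(\<Prod>v\<in>e. y v) = (\<Prod>v\<in>e \<inter> P. y v) * (\<Prod>v\<in>e - P. y v)"
        using fe by (metis Diff_Diff_Int Diff_subset mult.commute prod.subset_diff)
      also have "\<dots> = c * \<epsilon> ^ card (e - P)"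
        by (simp add: y_def c_def)
      finally have py: "(\<Prod>v\<in>e. y v) \<ge> c * \<epsilon> ^ 2"
        using \<epsilon> c card by (simp add: power_decreasing)
      have px: "(\<Prod>v\<in>e. x v) = 0" using Z0 z fe by (auto intro!: prod_zero)
      have "N y - N x = (\<Sum>d\<in>edges H. (\<Prod>v\<in>d. y v) - (\<Prod>v\<in>d. x v))"
        by (simp add: N_def sum_subtractf)
      also have "\<dots> \<ge> (\<Prod>v\<in>e. y v) - (\<Prod>v\<in>e. x v)"
      proof (rule member_le_sum[of e "edges H" "\<lambda>d. (\<Prod>v\<in>d. y v) - (\<Prod>v\<in>d. x v)"])
        fix d assume d: "d \<in> edges H - {e}"
        show "0 \<le> (\<Prod>v\<in>d. y v) - (\<Prod>v\<in>d. x v)"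
          using d edge_sub nonneg xy by (auto intro!: prod_mono)
      qed (use e finite_edges in auto)
      finally have N: "N y \<ge> N x + c * \<epsilon> ^ 2" using py px by simp
      have "D y - D x = (\<Sum>v\<in>verts H. y v ^ 3 - x v ^ 3)"
        by (simp add: D_def sum_subtractf)
      also have "\<dots> = (\<Sum>v\<in>e - P. y v ^ 3 - x v ^ 3)"
        using edge_sub e finite_verts by (intro sum.mono_neutral_right) (auto simp: y_def)
      also have "\<dots> = real (card (e - P)) * \<epsilon> ^ 3"
        using z by (simp add: y_def)
      also have "\<dots> \<le> 2 * \<epsilon> ^ 3" using card \<epsilon> by (intro mult_right_mono) auto
      finally have D: "D y \<le> D x + 2 * \<epsilon> ^ 3" by simp
      have "6 * N y \<le> r * D y"
      proof (rule N_le)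
        show "\<forall>v\<in>verts H. 0 \<le> y v" using xy nonneg by force
        show "\<exists>v\<in>verts H. y v \<noteq> 0" using xy nonneg nonzero by (metis order_antisym_conv)
      qed
      also have "\<dots> \<le> r * (D x + 2 * \<epsilon> ^ 3)" using D r_pos by simp
      finally have "6 * (c * \<epsilon>\<^sup>2) \<le> r * (2 * \<epsilon> ^ 3)"
        using N N_eq by (simp add: algebra_simps)
      also have "\<dots> = 2 * (r * \<epsilon>) * \<epsilon>\<^sup>2" by (simp add: power2_eq_square power3_eq_cube)
      also have "\<dots> \<le> 2 * c * \<epsilon>\<^sup>2" using \<epsilon> by (intro mult_right_mono) auto
      finally show False using c \<epsilon> by simp
    qed
  qed (auto simp: P_def)
  then show "v \<in> verts H \<Longrightarrow> x v > 0" by (auto simp: P_def)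
qed

text \<open>Only the coordinate at \<open>v\<close> varies. Maximality becomes a cubic polynomial in
  it, nonnegative for positive arguments and zero at \<open>x v\<close>; since
  \<open>x v > 0\<close> is an interior point, the derivative vanishes there.\<close>

lemma eigen:
  assumes v: "v \<in> verts H"
  shows "r * x v ^ 2 = 2 * (\<Sum>e\<in>{e\<in>edges H. v \<in> e}. \<Prod>u\<in>e - {v}. x u)"
proof -
  define A where "A = (\<Sum>e\<in>{e\<in>edges H. v \<in> e}. \<Prod>u\<in>e - {v}. x u)"
  define N' where "N' = (\<Sum>e\<in>{e\<in>edges H. v \<notin> e}. \<Prod>u\<in>e. x u)"
  define D' where "D' = (\<Sum>u\<in>verts H - {v}. x u ^ 3)"
  have N: "N (x(v := t)) = t * A + N'" for t
  proof -
    have "N (x(v := t)) = (\<Sum>e\<in>{e\<in>edges H. v \<in> e}. \<Prod>u\<in>e. (x(v := t)) u)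
        + (\<Sum>e\<in>{e\<in>edges H. v \<notin> e}. \<Prod>u\<in>e. (x(v := t)) u)"
      unfolding N_def using finite_edges
      by (subst sum.union_disjoint[symmetric]) (auto intro!: sum.cong)
    also have "(\<Sum>e\<in>{e\<in>edges H. v \<notin> e}. \<Prod>u\<in>e. (x(v := t)) u) = N'"
      unfolding N'_def by (intro sum.cong prod.cong) auto
    also have "(\<Sum>e\<in>{e\<in>edges H. v \<in> e}. \<Prod>u\<in>e. (x(v := t)) u) = t * A"
      unfolding A_def sum_distrib_left
    proof (intro sum.cong refl)
      fix e assume e: "e \<in> {e\<in>edges H. v \<in> e}"
      then have "(\<Prod>u\<in>e. (x(v := t)) u) = t * (\<Prod>u\<in>e - {v}. (x(v := t)) u)"
        using finite_edge by (subst prod.remove[of _ v]) auto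
      also have "(\<Prod>u\<in>e - {v}. (x(v := t)) u) = (\<Prod>u\<in>e - {v}. x u)"
        by (intro prod.cong) auto
      finally show "(\<Prod>u\<in>e. (x(v := t)) u) = t * (\<Prod>u\<in>e - {v}. x u)" .
    qed
    finally show ?thesis .
  qed
  have D: "D (x(v := t)) = t ^ 3 + D'" for t
    unfolding D_def D'_def using finite_verts v by (subst sum.remove[of _ v]) auto
  define h where "h t = r * (t ^ 3 + D') - 6 * (t * A + N')" for t
  have "(h has_real_derivative 3 * r * x v ^ 2 - 6 * A) (at (x v))"
    unfolding h_def by (auto intro!: derivative_eq_intros)
  moreover have "h (x v) \<le> h t" if "\<bar>x v - t\<bar> < x v" for t
  proof -
    have "t > 0" using that by auto
    have "h (x v) = 0" using N[of "x v"] D[of "x v"] N_eq by (simp add: h_def)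
    moreover have "6 * N (x(v := t)) \<le> r * D (x(v := t))"
      using nonneg \<open>t > 0\<close> v by (intro N_le) auto
    ultimately show ?thesis by (simp add: N D h_def)
  qed
  ultimately have "3 * r * x v ^ 2 - 6 * A = 0"
    using DERIV_local_min[of h _ "x v" "x v"] pos[OF v] by blast
  then show ?thesis by (simp add: A_def)
qed

end

definition inc :: "'a hypergraph \<Rightarrow> 'a \<Rightarrow> 'a set set" where
  "inc H v = {e \<in> edges H. v \<in> e}"

theorem quarter_weighting_exists:
  assumes "uniform_hypergraph 3 H" "connected_hypergraph H"
    and rho: "spectral_radius 3 H = 2 * root 3 4"
  obtains B :: "'a \<Rightarrow> 'a set \<Rightarrow> real" where
    "\<And>v e. e \<in> edges H \<Longrightarrow> v \<in> e \<Longrightarrow> B v e > 0"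
    "\<And>v. v \<in> verts H \<Longrightarrow> (\<Sum>e\<in>inc H v. B v e) = 1"
    "\<And>e. e \<in> edges H \<Longrightarrow> (\<Prod>v\<in>e. B v e) = 1 / 4"
proof -
  define r where "r = 2 * root 3 4"
  have r: "r > 0" "r ^ 3 = 32" by (simp_all add: r_def power_mult_distrib)
  \<comment> \<open>The empty hypergraph is excluded by the convention that its radius is 0.\<close>
  have ne: "verts H \<noteq> {}" using rho r by (auto simp: spectral_radius_def r_def)
  obtain x where x: "\<forall>v\<in>verts H. x v \<ge> 0" "\<exists>v\<in>verts H. x v \<noteq> 0"
     "rayleigh_quotient 3 H x = spectral_radius 3 H"
    using spectral_radius_is_max(1)[OF assms(1) ne] by blast
  interpret perron_vector H x r
    by unfold_locales (use assms x r ne spectral_radius_is_max(2)[OF assms(1) ne] in \<open>auto simp: r_def\<close>)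
  define B where "B v e = 2 * (\<Prod>u\<in>e. x u) / (r * x v ^ 3)" for v e
  show thesis
  proof
    have pp: "(\<Prod>u\<in>e. x u) > 0" if "e \<in> edges H" for e
      using that pos edge_sub by (intro prod_pos) auto
    show "B v e > 0" if "e \<in> edges H" "v \<in> e" for v e
      using that pp pos edge_sub r unfolding B_def
      by (intro divide_pos_pos mult_pos_pos zero_less_power) auto
    show "(\<Sum>e\<in>inc H v. B v e) = 1" if v: "v \<in> verts H" for v
    proof -
      have "(\<Sum>e\<in>inc H v. B v e) = (\<Sum>e\<in>inc H v. 2 / (r * x v ^ 2) * (\<Prod>u\<in>e - {v}. x u))"
      proof (intro sum.cong refl)
        fix e assume "e \<in> inc H v"
        then have "(\<Prod>u\<in>e. x u) = x v * (\<Prod>u\<in>e - {v}. x u)"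
          using finite_edge by (intro prod.remove) (auto simp: inc_def)
        then show "B v e = 2 / (r * x v ^ 2) * (\<Prod>u\<in>e - {v}. x u)"
          using pos[OF v] r by (simp add: B_def power2_eq_square power3_eq_cube)
      qed
      also have "\<dots> = 1 / (r * x v ^ 2) * (r * x v ^ 2)"
        unfolding eigen[OF v] by (simp add: inc_def sum_distrib_left)
      also have "\<dots> = 1" using pos[OF v] r by simp
      finally show ?thesis .
    qed
    show "(\<Prod>v\<in>e. B v e) = 1 / 4" if e: "e \<in> edges H" for e
    proof -
      define P where "P = (\<Prod>u\<in>e. x u)"
      have "(\<Prod>v\<in>e. B v e) = (2 * P / r) ^ 3 / (\<Prod>v\<in>e. x v ^ 3)"
        using edge_card[OF e] by (simp add: B_def P_def prod_dividef prod.distrib power_divide)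
      also have "\<dots> = 8 / r ^ 3"
        using pp[OF e] by (simp add: prod_power_distrib[symmetric] P_def[symmetric] power_divide power_mult_distrib)
      finally show ?thesis by (simp add: r)
    qed
  qed
qed

section \<open>Weights of pendant paths\<close>

locale quarter_weighting =
  fixes H :: "'a hypergraph" and B :: "'a \<Rightarrow> 'a set \<Rightarrow> real"
  assumes uniform: "uniform_hypergraph 3 H"
    and connected: "connected_hypergraph H"
    and B_pos: "e \<in> edges H \<Longrightarrow> v \<in> e \<Longrightarrow> B v e > 0"
    and B_sum: "v \<in> verts H \<Longrightarrow> (\<Sum>e\<in>inc H v. B v e) = 1"
    and B_prod: "e \<in> edges H \<Longrightarrow> (\<Prod>v\<in>e. B v e) = 1 / 4"
begin

abbreviation leaf :: "'a \<Rightarrow> 'a set \<Rightarrow> bool" where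
  "leaf v e \<equiv> inc H v = {e}"

definition triple :: "'a set \<Rightarrow> 'a \<Rightarrow> 'a \<Rightarrow> 'a \<Rightarrow> bool" where
  "triple e v a b \<longleftrightarrow> e \<in> edges H \<and> e = {v, a, b} \<and> v \<noteq> a \<and> v \<noteq> b \<and> a \<noteq> b"

definition W :: "'a \<Rightarrow> 'a set set \<Rightarrow> real" where
  "W v S = (\<Sum>e\<in>S. B v e)"

lemma finite_verts: "finite (verts H)" and edge_sub: "e \<in> edges H \<Longrightarrow> e \<subseteq> verts H"
  and edge_card: "e \<in> edges H \<Longrightarrow> card e = 3"
  using uniform by (auto simp: uniform_hypergraph_def)

lemma finite_edges: "finite (edges H)"
  using edge_sub finite_verts by (meson Pow_iff finite_Pow_iff finite_subset subsetI)

lemma finite_inc: "finite (inc H v)"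
  using finite_edges by (simp add: inc_def)

lemma inc_iff: "e \<in> inc H v \<longleftrightarrow> e \<in> edges H \<and> v \<in> e"
  by (simp add: inc_def)

lemma inc_vert: "e \<in> inc H v \<Longrightarrow> v \<in> verts H"
  using edge_sub by (auto simp: inc_def)

lemma obtain_triple:
  assumes "e \<in> edges H" "v \<in> e"
  obtains a b where "triple e v a b"
proof -
  have "card (e - {v}) = 2" using edge_card[OF assms(1)] assms(2) by simp
  then obtain a b where "e - {v} = {a, b}" "a \<noteq> b" by (meson card_2_iff)
  moreover from this have "e = {v, a, b}" using assms(2) by blast
  ultimately show thesis using that assms by (auto simp: triple_def)
qed

lemma triple_swap: "triple e v a b \<Longrightarrow> triple e v b a"
  and triple_rot: "triple e v a b \<Longrightarrow> triple e a b v"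
  by (auto simp: triple_def)

lemma triple_inc: "triple e v a b \<Longrightarrow> e \<in> inc H v" "triple e v a b \<Longrightarrow> e \<in> inc H a"
  "triple e v a b \<Longrightarrow> e \<in> inc H b"
  by (auto simp: triple_def inc_def)

lemma triple_prod: "triple e v a b \<Longrightarrow> B v e * B a e * B b e = 1 / 4"
  using B_prod[of e] by (auto simp: triple_def mult.assoc)

lemma B_pos': "e \<in> inc H v \<Longrightarrow> B v e > 0"
  using B_pos by (simp add: inc_iff)

lemma W_complement:
  assumes "e \<in> inc H v"
  shows "W v (inc H v - {e}) = 1 - B v e"
proof -
  have "W v (inc H v) = B v e + W v (inc H v - {e})"
    unfolding W_def using assms finite_inc by (rule sum.remove[rotated])
  then show ?thesis using B_sum[OF inc_vert[OF assms]] by (simp add: W_def)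
qed

lemma W_nonneg: "S \<subseteq> inc H v \<Longrightarrow> W v S \<ge> 0"
  unfolding W_def by (rule sum_nonneg) (use B_pos' in force)

lemma W_eq_0: "S \<subseteq> inc H v \<Longrightarrow> W v S = 0 \<longleftrightarrow> S = {}"
proof -
  assume S: "S \<subseteq> inc H v"
  then have "finite S" using finite_inc finite_subset by blast
  then show ?thesis unfolding W_def using S B_pos'
    by (subst sum_nonneg_eq_0_iff) (force simp: less_imp_le)+
qed

lemma B_le_1: "e \<in> inc H v \<Longrightarrow> B v e \<le> 1"
  using W_complement[of e v] W_nonneg[of "inc H v - {e}" v] by auto

lemma B_eq_1: "e \<in> inc H v \<Longrightarrow> B v e = 1 \<longleftrightarrow> leaf v e"
  using W_complement[of e v] W_eq_0[of "inc H v - {e}" v] by auto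

text \<open>The other two weights are at most 1, and the product of all three is
  \<open>1 / 4\<close>.\<close>

lemma B_ge: assumes "e \<in> inc H v" shows "B v e \<ge> 1 / 4"
proof -
  obtain a b where t: "triple e v a b" using obtain_triple assms by (metis inc_iff)
  note i = triple_inc[OF t]
  have "B a e * B b e \<le> 1"
    using B_le_1[OF i(2)] B_le_1[OF i(3)] B_pos'[OF i(2)] B_pos'[OF i(3)] by (simp add: mult_le_one)
  then have "B v e * (B a e * B b e) \<le> B v e * 1"
    using B_pos'[OF i(1)] by (intro mult_left_mono) auto
  then show ?thesis using triple_prod[OF t] by (simp add: mult.assoc)
qed

lemma W_ge_card: "S \<subseteq> inc H v \<Longrightarrow> W v S \<ge> card S / 4"
  unfolding W_def using sum_bounded_below[of S "1/4" "B v"] B_ge by fastforce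

lemma W_mono: "S \<subseteq> T \<Longrightarrow> T \<subseteq> inc H v \<Longrightarrow> W v S \<le> W v T"
  unfolding W_def
  by (rule sum_mono2) (auto simp: finite_subset[OF _ finite_inc] intro!: less_imp_le B_pos')

lemma W_single [simp]: "W v {e} = B v e" and W_empty [simp]: "W v {} = 0"
  by (simp_all add: W_def)

lemma small_W_single:
  assumes "S \<subseteq> inc H v" "W v S < 1 / 2" "S \<noteq> {}"
  obtains e where "S = {e}"
proof -
  have "finite S" using finite_inc assms finite_subset by blast
  moreover have "card S < 2" using W_ge_card[OF assms(1)] assms(2) by simp
  moreover have "card S \<noteq> 0" using \<open>finite S\<close> assms(3) by simp
  ultimately have "card S = 1" by linarith
  then show thesis using that by (meson card_1_singletonE)
qed

lemma nonleaf_le: 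
  assumes "e \<in> inc H v" "\<not> leaf v e" shows "B v e \<le> 3 / 4"
proof -
  obtain d where "d \<in> inc H v" "d \<noteq> e" using assms by blast
  then have "B v d \<le> W v (inc H v - {e})" using W_mono[of "{d}" "inc H v - {e}" v] by simp
  then show ?thesis using B_ge[OF \<open>d \<in> inc H v\<close>] W_complement[OF assms(1)] by simp
qed

text \<open>The weight of a pendant path with \<open>k\<close> edges at the vertex where it is attached.\<close>

definition path_weight :: "nat \<Rightarrow> real" where
  "path_weight k = k / (2 * (k + 1))"

text \<open>\<open>S\<close> holds the edges at \<open>v\<close> that belong to the path, so its
  continuation at \<open>b\<close> is \<open>inc H b - {e}\<close>, and length 0 there makes
  \<open>b\<close> a leaf. The description is purely local: that later edges avoid earlier ones
  follows only from the counting argument for completed covers.\<close>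

fun pendant :: "nat \<Rightarrow> 'a \<Rightarrow> 'a set set \<Rightarrow> bool" where
  "pendant 0 v S \<longleftrightarrow> S = {}"
| "pendant (Suc k) v S \<longleftrightarrow>
     (\<exists>e a b. S = {e} \<and> triple e v a b \<and> leaf a e \<and> pendant k b (inc H b - {e}))"

text \<open>A vertex has weight \<open>3 / 4\<close> in \<open>e\<close> iff its only other edge is a pendant edge.\<close>

definition two_pendants :: "'a set \<Rightarrow> bool" where
  "two_pendants e \<longleftrightarrow> (\<exists>v a b. triple e v a b \<and> B a e = 3 / 4 \<and> B b e = 3 / 4)"

lemma path_weight_mono: "m \<le> n \<Longrightarrow> path_weight m \<le> path_weight n"
  by (simp add: path_weight_def frac_le_eq divide_le_0_iff algebra_simps)

lemma path_weight_lt_half: "path_weight n < 1 / 2"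
  by (simp add: path_weight_def divide_less_eq)

text \<open>The recursion for prolonging a pendant path: across an edge with a leaf
  \<open>B v e * B b e = 1 / 4\<close>, and a path of length \<open>k\<close> at \<open>b\<close>
  leaves \<open>1 - path_weight k\<close> for \<open>B b e\<close>.\<close>

lemma path_weight_Suc: "path_weight (Suc k) = 1 / (4 * (1 - path_weight k))"
proof -
  have "1 - path_weight k = (k + 2) / (2 * (k + 1))"
    by (simp add: path_weight_def diff_divide_eq_iff add.commute)
  moreover have "path_weight (Suc k) = (k + 1) / (2 * (k + 2))"
    by (simp add: path_weight_def add.commute)
  ultimately show ?thesis by (simp only:) (simp add: frac_eq_eq algebra_simps)
qed

lemma path_weight_inj: "path_weight m = path_weight n \<longleftrightarrow> m = n"
  by (simp add: path_weight_def frac_eq_eq algebra_simps)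

lemma leaf_edge_weight:
  assumes "triple e v a b" "leaf a e"
  shows "B v e * B b e = 1 / 4"
  using triple_prod[OF assms(1)] B_eq_1[of e a] triple_inc(2)[OF assms(1)] assms(2) by simp

lemma pendant_step:
  assumes t: "triple e v a b" and leaf: "leaf a e" and lt: "B v e < path_weight (Suc n)"
  shows "W b (inc H b - {e}) < path_weight n"
    and "W b (inc H b - {e}) = path_weight k \<Longrightarrow> B v e = path_weight (Suc k)"
proof -
  note i = triple_inc[OF t]
  have p: "B v e * B b e = 1 / 4" by (rule leaf_edge_weight[OF t leaf])
  have pos: "B v e > 0" "B b e > 0" using i B_pos' by auto
  have c: "W b (inc H b - {e}) = 1 - B b e" by (rule W_complement[OF i(3)])
  have n: "1 - path_weight n > 0" using path_weight_lt_half[of n] by simp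
  have "B v e * (4 * (1 - path_weight n)) < 1"
    using lt n by (simp add: path_weight_Suc less_divide_eq)
  then have "B v e * (4 * (1 - path_weight n)) < B v e * (4 * B b e)"
    using p by simp
  then show "W b (inc H b - {e}) < path_weight n"
    using pos by (simp add: c)
  assume "W b (inc H b - {e}) = path_weight k"
  then have "path_weight (Suc k) = 1 / (4 * B b e)" by (simp add: c path_weight_Suc)
  moreover have "B v e = 1 / (4 * B b e)" using p pos by (simp add: field_simps)
  ultimately show "B v e = path_weight (Suc k)" by simp
qed

text \<open>Descent in \<open>n\<close>: as \<open>s \<mapsto> 1 / (4 * (1 - s))\<close> is
  increasing, crossing an edge lowers the bound from \<open>path_weight (Suc n)\<close> to
  \<open>path_weight n\<close>, and no set of edges lies below \<open>path_weight 0 = 0\<close>. So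
  the path ends, and its weight tells its length.\<close>

lemma pendant_if_leaf:
  assumes "\<And>e v a b. triple e v a b \<Longrightarrow> B v e < path_weight n \<Longrightarrow> leaf a e \<or> leaf b e"
    and "S \<subseteq> inc H v" "W v S < path_weight n"
  shows "\<exists>k<n. W v S = path_weight k \<and> pendant k v S"
  using assms
proof (induction n arbitrary: v S)
  case 0
  then show ?case using W_nonneg[of S v] by (simp add: path_weight_def)
next
  case (Suc n)
  show ?case
  proof (cases "S = {}")
    case True
    then show ?thesis by (intro exI[of _ 0]) (simp add: path_weight_def)
  next
    case False
    then obtain e where e: "S = {e}"
      using small_W_single[OF Suc.prems(2)] Suc.prems(3) path_weight_lt_half
      by (meson less_trans)
    obtain a b where t0: "triple e v a b"
      using obtain_triple e Suc.prems(2) by (metis inc_iff insert_subset)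
    have lt: "B v e < path_weight (Suc n)" using Suc.prems(3) by (simp add: e)
    obtain a b where t: "triple e v a b" and l: "leaf a e"
      using Suc.prems(1)[OF t0 lt] t0 triple_swap[OF t0] by blast
    have mono: "path_weight n \<le> path_weight (Suc n)" by (rule path_weight_mono) simp
    obtain k where "k < n" "W b (inc H b - {e}) = path_weight k" "pendant k b (inc H b - {e})"
      using Suc.IH[of "inc H b - {e}" b] Suc.prems(1) mono pendant_step(1)[OF t l lt]
      by (meson Diff_subset less_le_trans)
    then show ?thesis using pendant_step(2)[OF t l lt] t l e
      by (intro exI[of _ "Suc k"]) auto
  qed
qed

text \<open>The limit 8 comes from \<open>path_weight 8 = 4 / 9\<close>. If neither other vertex of
  an edge at \<open>v\<close> is a leaf, each has weight at most \<open>3 / 4\<close>, because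
  another edge takes \<open>1 / 4\<close> or more; then the weight at \<open>v\<close> is at least
  \<open>(1 / 4) / (9 / 16) = 4 / 9\<close>. Lighter edges thus have the leaf that the descent
  needs.\<close>

lemma short_pendant:
  assumes "S \<subseteq> inc H v" "W v S < path_weight n" "n \<le> 8"
  shows "\<exists>k<n. W v S = path_weight k \<and> pendant k v S"
proof (rule pendant_if_leaf[OF _ assms(1,2)])
  fix e v a b assume t: "triple e v a b" and lt: "B v e < path_weight n"
  have "path_weight 8 = 4 / 9" by (simp add: path_weight_def)
  then have v: "B v e < 4 / 9" using lt path_weight_mono[OF assms(3)] by simp
  show "leaf a e \<or> leaf b e"
  proof (rule ccontr)
    assume "\<not> (leaf a e \<or> leaf b e)"
    then have ab: "B a e \<le> 3/4" "B b e \<le> 3/4" "B a e > 0" "B b e > 0"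
      using nonleaf_le triple_inc[OF t] B_pos' by auto
    then have "B a e * B b e \<le> 3/4 * (3/4)" by (intro mult_mono) auto
    then have "B v e * (B a e * B b e) < 4/9 * (9/16)"
      using v ab B_pos'[OF triple_inc(1)[OF t]]
      by (intro mult_less_le_imp_less) auto
    then show False using triple_prod[OF t] by (simp add: mult.assoc)
  qed
qed

lemma pendant_if_short:
  assumes "S \<subseteq> inc H v" "W v S = path_weight k" "k \<le> 7"
  shows "pendant k v S"
proof -
  have "path_weight k < path_weight 8" using assms(3) path_weight_mono[of k 7]
    by (simp add: path_weight_def)
  then show ?thesis using short_pendant[of S v 8] assms by (auto simp: path_weight_inj)
qed

text \<open>\<open>4 / 7\<close> is \<open>1 - path_weight 6\<close>, so what \<open>v\<close> has
  beside \<open>e\<close> is a pendant path of length \<open>k < 6\<close>; the list consists of the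
  values \<open>1 - path_weight k\<close>.\<close>

lemma B_cases:
  assumes "e \<in> inc H v" "B v e > 4 / 7"
  shows "B v e \<in> {1, 3/4, 2/3, 5/8, 3/5, 7/12}"
proof -
  have "W v (inc H v - {e}) < path_weight 6"
    using assms W_complement[of e v] by (simp add: path_weight_def)
  then obtain k where "k < 6" "1 - B v e = path_weight k"
    using short_pendant[of "inc H v - {e}" v 6] W_complement[of e v] assms by auto
  moreover from \<open>k < 6\<close> have "k \<in> {0, 1, 2, 3, 4, 5}" by auto
  ultimately show ?thesis
    by (auto simp: path_weight_def)
qed

text \<open>An edge lighter than \<open>1 / 2\<close> at \<open>v\<close> and without another leaf
  needs a product above \<open>1 / 2\<close> at its other two vertices. Both weights then exceed
  \<open>2 / 3\<close>, and the only such weight of a nonleaf is \<open>3 / 4\<close>: this is the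
  excluded configuration. It makes paths of length 8 and 14 accessible.\<close>

lemma pendant_if_no_two:
  assumes no: "\<And>e. \<not> two_pendants e" and S: "S \<subseteq> inc H v" and W: "W v S = path_weight k"
  shows "pendant k v S"
proof -
  have "\<exists>j<Suc k. W v S = path_weight j \<and> pendant j v S"
  proof (rule pendant_if_leaf[OF _ S])
    fix e v a b assume t: "triple e v a b" and "B v e < path_weight (Suc k)"
    then have v: "B v e < 1 / 2" using path_weight_lt_half[of "Suc k"] by simp
    note i = triple_inc[OF t]
    show "leaf a e \<or> leaf b e"
    proof (rule ccontr)
      assume nl: "\<not> (leaf a e \<or> leaf b e)"
      then have ab: "B a e \<le> 3/4" "B b e \<le> 3/4" "B a e > 0" "B b e > 0"
        using nonleaf_le i B_pos' by auto
      have P: "B a e * B b e > 1/2"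
      proof (rule ccontr)
        assume "\<not> B a e * B b e > 1/2"
        then have "B v e * (B a e * B b e) \<le> B v e * (1/2)"
          using B_pos'[OF i(1)] by (intro mult_left_mono) auto
        then show False using v triple_prod[OF t] by (simp add: mult.assoc)
      qed
      have "B a e * (3/4) \<ge> B a e * B b e" "3/4 * B b e \<ge> B a e * B b e"
        using ab by (intro mult_left_mono mult_right_mono; simp)+
      then have "B a e > 2/3" "B b e > 2/3" using P by auto
      then have "B a e = 3/4" "B b e = 3/4" using B_cases[OF i(2)] B_cases[OF i(3)] ab by auto
      then show False using no t by (auto simp: two_pendants_def)
    qed
  next
    show "W v S < path_weight (Suc k)"
      using W path_weight_mono[of k "Suc k"] path_weight_inj[of k "Suc k"] by simp
  qed
  then show ?thesis using W by (auto simp: path_weight_inj)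
qed

end

section \<open>Partial covers by special hypergraphs\<close>

lemma attach_one:
  "attach v (Suc 0) K = (let m = Suc (Max (verts K)) in (verts K \<union> {m, Suc m}, edges K \<union> {{v, m, Suc m}}))"
proof -
  have "{m..<m + 2} = {m, Suc m}" for m :: nat by auto
  then show ?thesis by (simp add: attach_def pendant_edge_def Let_def lessThan_Suc)
qed

lemma Max_attach_one:
  assumes "finite (verts K)"
  shows "Max (verts (attach v 1 K)) = Suc (Suc (Max (verts K)))"
proof (rule Max_eqI)
  fix y assume "y \<in> verts (attach v 1 K)"
  moreover have "y \<le> Max (verts K)" if "y \<in> verts K" using assms that by simp
  ultimately show "y \<le> Suc (Suc (Max (verts K)))" by (auto simp: attach_one Let_def)
qed (use assms in \<open>auto simp: attach_one Let_def\<close>)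

text \<open>Explorations proceed edge by edge, whereas \<open>attach\<close> adds a whole path. Both
  agree literally, as fresh vertices are numbered from the current maximum; the last vertex of a new
  edge is that maximum plus 2.\<close>

lemma attach_Suc:
  assumes "finite (verts K)"
  shows "attach v (Suc k) K = attach (Suc (Suc (Max (verts K)))) k (attach v 1 K)"
proof -
  define m where "m = Suc (Max (verts K))"
  have M: "Suc (Max (verts (attach v 1 K))) = m + 2"
    using Max_attach_one[OF assms] by (simp add: m_def)
  have "pendant_edge m v ` {..<Suc k} = insert (pendant_edge m v 0) ((\<lambda>i. pendant_edge m v (Suc i)) ` {..<k})"
    by (simp add: lessThan_Suc_eq_insert_0 image_image)
  also have "(\<lambda>i. pendant_edge m v (Suc i)) ` {..<k} = pendant_edge (m + 2) (Suc m) ` {..<k}"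
    by (intro image_cong) (auto simp: pendant_edge_def)
  also have "pendant_edge m v 0 = {v, m, Suc m}" by (simp add: pendant_edge_def)
  finally have e: "pendant_edge m v ` {..<Suc k} =
      insert {v, m, Suc m} (pendant_edge (m + 2) (Suc m) ` {..<k})" .
  have i: "{m..<m + 2 * Suc k} = {m, Suc m} \<union> {m + 2..<m + 2 + 2 * k}" by auto
  have A: "attach v 1 K = (verts K \<union> {m, Suc m}, edges K \<union> {{v, m, Suc m}})"
    by (simp add: attach_one m_def Let_def)
  have "attach (Suc m) k (attach v 1 K) = (verts K \<union> {m, Suc m} \<union> {m + 2..<m + 2 + 2 * k},
      edges K \<union> {{v, m, Suc m}} \<union> pendant_edge (m + 2) (Suc m) ` {..<k})"
    unfolding attach_def[of "Suc m" k] M Let_def unfolding A by simp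
  moreover have "attach v (Suc k) K = (verts K \<union> ({m, Suc m} \<union> {m + 2..<m + 2 + 2 * k}),
      edges K \<union> insert {v, m, Suc m} (pendant_edge (m + 2) (Suc m) ` {..<k}))"
    unfolding attach_def m_def[symmetric] Let_def e i ..
  ultimately show ?thesis by (simp add: m_def Un_assoc)
qed

lemma path_graph_eq_attach: "path_graph k = attach 0 k ({0}, {})"
proof -
  have "pendant_edge 1 0 i = path_edge i" for i
    by (auto simp: pendant_edge_def path_edge_def)
  moreover have "{0..2 * k} = insert 0 {1..<1 + 2 * k}" by auto
  ultimately show ?thesis by (simp add: path_graph_def attach_def)
qed

lemma Max_path_graph: "Max (verts (path_graph k)) = 2 * k"
  by (auto simp: path_graph_def intro!: Max_eqI)

text \<open>An equality and not merely an isomorphism, since both sides number consecutively; a walk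
  prolonged at its end remains a \<open>path_graph\<close>.\<close>

lemma attach_path_graph: "attach (2 * k) j (path_graph k) = path_graph (k + j)"
proof -
  have "pendant_edge (Suc (2 * k)) (2 * k) ` {..<j} = path_edge ` {k..<k + j}"
  proof -
    have "{k..<k + j} = (\<lambda>i. k + i) ` {..<j}"
      by (metis add.commute add.right_neutral atLeast0LessThan image_add_atLeastLessThan)
    moreover have "pendant_edge (Suc (2 * k)) (2 * k) i = path_edge (k + i)" for i
      by (auto simp: pendant_edge_def path_edge_def)
    ultimately show ?thesis by (simp add: image_image)
  qed
  moreover have "{..<k + j} = {..<k} \<union> {k..<k + j}" by auto
  ultimately show ?thesis
    unfolding attach_def Max_path_graph by (auto simp: path_graph_def Let_def)
qed

lemma hypergraph_isoI:
  assumes bij: "bij_betw f (verts K) (verts H)" and E: "edges H = (`) f ` edges K"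
    and sub: "\<And>d. d \<in> edges K \<Longrightarrow> d \<subseteq> verts K"
  shows "hypergraph_iso H K"
proof -
  define g where "g = the_inv_into (verts K) f"
  have "bij_betw g (verts H) (verts K)" unfolding g_def using bij by (rule bij_betw_the_inv_into)
  moreover have "edges K = (\<lambda>e. g ` e) ` edges H"
  proof -
    have "g ` f ` d = d" if d: "d \<in> edges K" for d
    proof -
      have "g (f p) = p" if "p \<in> d" for p
        using bij sub[OF d] that unfolding g_def by (auto simp: bij_betw_def the_inv_into_f_f)
      then show ?thesis by (simp add: image_image)
    qed
    then show ?thesis by (simp add: E image_image)
  qed
  ultimately show ?thesis unfolding hypergraph_iso_def by blast
qed

section \<open>Locally bijective maps and the size of their fibres\<close>

context quarter_weighting
begin

text \<open>A map into \<open>H\<close> that is bijective on the edges at each vertex \<open>p\<close>, up to the set \<open>M p\<close> of edges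
  at \<open>f p\<close> that are not yet in the image. The condition on the numbers of vertices and edges
  holds for hypertrees and is what makes a completed map injective.\<close>

definition partial_cover :: "nat hypergraph \<Rightarrow> (nat \<Rightarrow> 'a) \<Rightarrow> (nat \<Rightarrow> 'a set set) \<Rightarrow> bool" where
  "partial_cover K f M \<longleftrightarrow>
     uniform_hypergraph 3 K \<and> card (verts K) = 2 * card (edges K) + 1 \<and>
     f ` verts K \<subseteq> verts H \<and>
     (\<forall>p\<in>verts K. M p \<subseteq> inc H (f p) \<and> bij_betw ((`) f) (inc K p) (inc H (f p) - M p)) \<and>
     (\<forall>p. p \<notin> verts K \<longrightarrow> M p = {})"

lemma partial_cover_vertex:
  assumes "v \<in> verts H"
  shows "partial_cover ({0}, {}) (\<lambda>_. v) ((\<lambda>_. {})(0 := inc H v))"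
  using assms by (auto simp: partial_cover_def uniform_hypergraph_def inc_def bij_betw_def)

text \<open>The new vertices of \<open>K\<close> are fresh numbers even if \<open>a\<close> or
  \<open>b\<close> is already an image, so nothing has to be compared with earlier parts of the
  exploration. Two vertices and one edge are added, which preserves the count.\<close>

lemma partial_cover_attach_edge:
  assumes pc: "partial_cover K f M" and p: "p \<in> verts K" and e: "e \<in> M p"
    and t: "triple e (f p) a b" and m: "m = Suc (Max (verts K))"
  shows "partial_cover (attach p 1 K) (f(m := a, Suc m := b))
      (M(p := M p - {e}, m := inc H a - {e}, Suc m := inc H b - {e}))"
proof -
  define f' where "f' = f(m := a, Suc m := b)"
  define M' where "M' = M(p := M p - {e}, m := inc H a - {e}, Suc m := inc H b - {e})"
  define d where "d = {p, m, Suc m}"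
  define K' where "K' = (verts K \<union> {m, Suc m}, edges K \<union> {d})"
  have K': "attach p 1 K = K'" by (simp add: attach_one K'_def d_def m Let_def)
  have un: "uniform_hypergraph 3 K" and cd: "card (verts K) = 2 * card (edges K) + 1"
    and fV: "f ` verts K \<subseteq> verts H"
    and M: "\<And>q. q \<in> verts K \<Longrightarrow> M q \<subseteq> inc H (f q)"
    and bij: "\<And>q. q \<in> verts K \<Longrightarrow> bij_betw ((`) f) (inc K q) (inc H (f q) - M q)"
    and out: "\<And>q. q \<notin> verts K \<Longrightarrow> M q = {}"
    using pc by (auto simp: partial_cover_def)
  have fin: "finite (verts K)" using un by (simp add: uniform_hypergraph_def)
  have finE: "finite (edges K)"
    using un by (intro finite_subset[of "edges K" "Pow (verts K)"]) (auto simp: uniform_hypergraph_def)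
  have lt: "q < m" if "q \<in> verts K" for q
    using Max_ge[OF fin that] by (simp add: m)
  have mV: "m \<notin> verts K" "Suc m \<notin> verts K" "p < m" using lt p by force+
  have sub: "d0 \<subseteq> verts K" if "d0 \<in> edges K" for d0
    using un that by (simp add: uniform_hypergraph_def)
  have dE: "d \<notin> edges K" using sub[of d] mV by (auto simp: d_def)
  have img: "f' ` d0 = f ` d0" if "d0 \<in> edges K" for d0
    using sub[OF that] mV by (intro image_cong) (auto simp: f'_def)
  have imd: "f' ` d = e"
    using t mV by (auto simp: f'_def d_def triple_def)
  have ti: "e \<in> inc H a" "e \<in> inc H b" "e \<in> inc H (f p)" using triple_inc[OF t] by auto
  have "partial_cover K' f' M'"
    unfolding partial_cover_def
  proof (intro conjI ballI allI impI)
    show "uniform_hypergraph 3 K'"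
      using un fin mV p unfolding uniform_hypergraph_def K'_def d_def by auto
    show "card (verts K') = 2 * card (edges K') + 1"
      using cd fin finE mV dE by (simp add: K'_def)
    show "f' ` verts K' \<subseteq> verts H"
      using fV ti inc_vert by (auto simp: K'_def f'_def)
  next
    fix q assume q: "q \<in> verts K'"
    consider "q = p" | "q \<in> verts K" "q \<noteq> p" | "q = m" | "q = Suc m"
      using q by (auto simp: K'_def)
    then have "M' q \<subseteq> inc H (f' q) \<and> bij_betw ((`) f') (inc K' q) (inc H (f' q) - M' q)"
    proof cases
      case 1
      have b: "bij_betw ((`) f') (inc K p) (inc H (f p) - M p)"
        using bij[OF p] img by (subst bij_betw_cong[of _ _ "(`) f"]) (auto simp: inc_def)
      have "d \<notin> inc K p" using dE by (simp add: inc_def)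
      moreover have "f' ` d \<notin> inc H (f p) - M p" using imd e by simp
      ultimately have "bij_betw ((`) f') (inc K p \<union> {d}) ((inc H (f p) - M p) \<union> {f' ` d})"
        by (rule notIn_Un_bij_betw[OF _ _ b])
      moreover have "inc K' p = inc K p \<union> {d}" by (auto simp: inc_def K'_def d_def)
      moreover have "f' p = f p" "M' p = M p - {e}" using mV by (auto simp: f'_def M'_def)
      moreover have "(inc H (f p) - M p) \<union> {f' ` d} = inc H (f p) - (M p - {e})"
        using imd ti by auto
      ultimately show ?thesis using 1 M[OF p] by auto
    next
      case 2
      then have "q \<notin> d" using mV by (auto simp: d_def)
      then have "inc K' q = inc K q" by (auto simp: inc_def K'_def)
      moreover have "f' q = f q" "M' q = M q" using mV 2 by (auto simp: f'_def M'_def)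
      moreover have "bij_betw ((`) f') (inc K q) (inc H (f q) - M q)"
        using bij[OF 2(1)] img by (subst bij_betw_cong[of _ _ "(`) f"]) (auto simp: inc_def)
      ultimately show ?thesis using M[OF 2(1)] by simp
    next
      case 3
      then have "inc K' q = {d}" using sub mV by (auto simp: inc_def K'_def d_def)
      moreover have "f' q = a" "M' q = inc H a - {e}" using mV 3 by (auto simp: f'_def M'_def)
      moreover have "inc H a - (inc H a - {e}) = {e}" using ti by auto
      ultimately show ?thesis using imd by (auto simp: bij_betw_def)
    next
      case 4
      then have "inc K' q = {d}" using sub mV by (auto simp: inc_def K'_def d_def)
      moreover have "f' q = b" "M' q = inc H b - {e}" using mV 4 by (auto simp: f'_def M'_def)
      moreover have "inc H b - (inc H b - {e}) = {e}" using ti by auto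
      ultimately show ?thesis using imd by (auto simp: bij_betw_def)
    qed
    then show "M' q \<subseteq> inc H (f' q)" "bij_betw ((`) f') (inc K' q) (inc H (f' q) - M' q)" by auto
  next
    fix q assume "q \<notin> verts K'"
    then show "M' q = {}" using out p by (auto simp: K'_def M'_def)
  qed
  then show ?thesis unfolding K' f'_def M'_def .
qed

lemma partial_cover_finite: "partial_cover K f M \<Longrightarrow> finite (verts K)"
  by (simp add: partial_cover_def uniform_hypergraph_def)

lemma partial_cover_attach:
  assumes "partial_cover K f M" "p \<in> verts K" "S \<subseteq> M p" "pendant k (f p) S"
  shows "\<exists>f'. partial_cover (attach p k K) f' (M(p := M p - S)) \<and> (\<forall>q\<in>verts K. f' q = f q)"
  using assms
proof (induction k arbitrary: K f M p S)
  case 0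
  then show ?case by (intro exI[of _ f]) auto
next
  case (Suc k)
  obtain e a b where e: "S = {e}" and t: "triple e (f p) a b" and l: "leaf a e"
    and pb: "pendant k b (inc H b - {e})"
    using Suc.prems(4) by auto
  define m where "m = Suc (Max (verts K))"
  define f1 where "f1 = f(m := a, Suc m := b)"
  define M1 where "M1 = M(p := M p - {e}, m := inc H a - {e}, Suc m := inc H b - {e})"
  have fin: "finite (verts K)" using Suc.prems(1) partial_cover_finite by blast
  have mV: "m \<notin> verts K" "Suc m \<notin> verts K"
    using Max_ge[OF fin, of m] Max_ge[OF fin, of "Suc m"] by (auto simp: m_def)
  have M0: "M m = {}" "M (Suc m) = {}"
    using mV Suc.prems(1) by (auto simp: partial_cover_def)
  have pc1: "partial_cover (attach p 1 K) f1 M1"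
    unfolding f1_def M1_def using Suc.prems e t m_def by (intro partial_cover_attach_edge) auto
  have V1: "verts (attach p 1 K) = verts K \<union> {m, Suc m}"
    by (simp add: attach_one m_def Let_def)
  obtain f' where f': "partial_cover (attach (Suc m) k (attach p 1 K)) f' (M1(Suc m := M1 (Suc m) - (inc H b - {e})))"
      and ff: "\<forall>q\<in>verts (attach p 1 K). f' q = f1 q"
  proof (atomize_elim, rule Suc.IH[OF pc1])
    show "Suc m \<in> verts (attach p 1 K)" unfolding V1 by simp
  qed (use pb in \<open>auto simp: M1_def f1_def\<close>)
  have K: "attach (Suc m) k (attach p 1 K) = attach p (Suc k) K"
    unfolding m_def by (rule attach_Suc[OF fin, symmetric])
  have M: "M1(Suc m := M1 (Suc m) - (inc H b - {e})) = M(p := M p - S)"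
    using l M0 mV Suc.prems(2) by (auto simp: M1_def e fun_eq_iff)
  have "f' q = f q" if "q \<in> verts K" for q
  proof -
    have "f' q = f1 q" using ff that unfolding V1 by blast
    then show ?thesis using mV that by (auto simp: f1_def)
  qed
  then show ?case using f' unfolding K M by blast
qed

lemma partial_cover_complete:
  assumes pc: "partial_cover K f (\<lambda>_. {})"
  shows "hypergraph_iso H K"
proof -
  let ?F = "(`) f"
  have un: "uniform_hypergraph 3 K" and cd: "card (verts K) = 2 * card (edges K) + 1"
    and fV: "f ` verts K \<subseteq> verts H"
    and bij: "\<And>p. p \<in> verts K \<Longrightarrow> bij_betw ?F (inc K p) (inc H (f p))"
    using pc by (auto simp: partial_cover_def)
  have fin: "finite (verts K)" using un by (simp add: uniform_hypergraph_def)
  have sub: "d \<subseteq> verts K" "card d = 3" if "d \<in> edges K" for d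
    using un that by (auto simp: uniform_hypergraph_def)
  have finE: "finite (edges K)"
    using sub fin by (intro finite_subset[of "edges K" "Pow (verts K)"]) auto
  have img: "f ` d \<in> edges H" if d: "d \<in> edges K" for d
  proof -
    obtain p where "p \<in> d" using sub(2)[OF d] by fastforce
    then have "f ` d \<in> inc H (f p)"
      using bij[of p] sub(1)[OF that] that bij_betw_apply[of ?F "inc K p" _ d] by (auto simp: inc_def)
    then show ?thesis by (simp add: inc_def)
  qed
  have inj: "inj_on f d" if "d \<in> edges K" for d
    using edge_card[OF img[OF that]] sub(2)[OF that]
    by (intro eq_card_imp_inj_on) (auto intro: card_ge_0_finite)
  define nv where "nv v = card {p\<in>verts K. f p = v}" for v
  define ne where "ne e = card {d\<in>edges K. f ` d = e}" for e
  have nv_ne: "nv v = ne e" if e: "e \<in> inc H v" for v e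
  proof -
    \<comment> \<open>Both fibres are in bijection with the flags over \<open>(v, e)\<close>: a flag
      is determined by its vertex, since \<open>f\<close> is bijective on the edges there, and by
      its edge, since \<open>f\<close> is injective on it.\<close>
    define Q where "Q = {(p, d). p \<in> d \<and> d \<in> edges K \<and> f p = v \<and> f ` d = e}"
    have "bij_betw fst Q {p\<in>verts K. f p = v}"
    proof (intro bij_betwI' conjI)
      fix x y assume x: "x \<in> Q" and y: "y \<in> Q"
      then show "fst x = fst y \<longleftrightarrow> x = y"
        using bij[of "fst x"] sub(1) unfolding Q_def bij_betw_def inj_on_def inc_def
        by clarsimp (metis (no_types, lifting) subsetD)
    next
      fix x assume "x \<in> Q"
      then show "fst x \<in> {p \<in> verts K. f p = v}" using sub(1) by (fastforce simp: Q_def)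
    next
      fix p assume p: "p \<in> {p \<in> verts K. f p = v}"
      then have "e \<in> ?F ` inc K p" using bij[of p] e by (auto simp: bij_betw_def)
      then show "\<exists>x\<in>Q. p = fst x" using p by (force simp: Q_def inc_def)
    qed
    moreover have "bij_betw snd Q {d\<in>edges K. f ` d = e}"
    proof (intro bij_betwI')
      fix x y assume x: "x \<in> Q" and y: "y \<in> Q"
      then show "snd x = snd y \<longleftrightarrow> x = y"
        using inj[of "snd x"] unfolding Q_def inj_on_def by force
    next
      fix x assume "x \<in> Q"
      then show "snd x \<in> {d\<in>edges K. f ` d = e}" by (auto simp: Q_def)
    next
      fix d assume d: "d \<in> {d\<in>edges K. f ` d = e}"
      then obtain p where "p \<in> d" "f p = v" using e by (force simp: inc_def)
      then show "\<exists>x\<in>Q. d = snd x" using d by (force simp: Q_def)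
    qed
    ultimately show ?thesis by (metis bij_betw_same_card nv_def ne_def)
  qed
  obtain p0 where p0: "p0 \<in> verts K" using cd fin by (metis add_is_0 card.empty ex_in_conv one_neq_zero)
  define c where "c = nv (f p0)"
  define A where "A = {v\<in>verts H. nv v = c}"
  have "A = verts H"
  proof (rule connected_hypergraph_closed[OF connected])
    show "A \<noteq> {}" using p0 fV by (auto simp: A_def c_def)
    show "e \<inter> verts H \<subseteq> A" if e: "e \<in> edges H" "e \<inter> A \<noteq> {}" for e
    proof -
      obtain v where v: "v \<in> e" "nv v = c" using e by (auto simp: A_def)
      then have "ne e = c" using nv_ne[of e v] that by (simp add: inc_def)
      then show ?thesis using nv_ne[of e] that by (auto simp: A_def inc_def)
    qed
  qed (auto simp: A_def)
  then have nv: "nv v = c" if "v \<in> verts H" for v using that by (auto simp: A_def)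
  have ne: "ne e = c" if e: "e \<in> edges H" for e
  proof -
    obtain v where "v \<in> e" using edge_card[OF e] by fastforce
    then show ?thesis using nv_ne[of e v] nv[of v] edge_sub[OF that] that by (auto simp: inc_def)
  qed
  have "card (verts K) = (\<Sum>v\<in>verts H. nv v)"
    using sum.group[OF fin finite_verts fV, of "\<lambda>_. 1::nat"] by (simp add: nv_def)
  then have cV: "card (verts K) = c * card (verts H)" using nv by simp
  have "card (edges K) = (\<Sum>e\<in>edges H. ne e)"
    using sum.group[OF finE finite_edges, of ?F "\<lambda>_. 1::nat"] img by (simp add: ne_def image_subset_iff)
  then have cE: "card (edges K) = c * card (edges H)" using ne by simp
  have "c * card (verts H) = c * (2 * card (edges H)) + 1" using cd cV cE by simp
  then have "c dvd 1" by (metis dvd_add_right_iff dvd_triv_left)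
  then have c1: "c = 1" by simp
  have bf: "bij_betw f (verts K) (verts H)"
    unfolding bij_betw_def
  proof
    show "inj_on f (verts K)"
    proof (rule inj_onI)
      fix p q assume pq: "p \<in> verts K" "q \<in> verts K" "f p = f q"
      then have "nv (f p) = 1" using nv c1 fV by auto
      then obtain z where "{p'\<in>verts K. f p' = f p} = {z}" unfolding nv_def by (rule card_1_singletonE)
      then show "p = q" using pq by (metis (mono_tags, lifting) mem_Collect_eq singletonD)
    qed
    show "f ` verts K = verts H"
    proof
      show "verts H \<subseteq> f ` verts K"
      proof
        fix v assume "v \<in> verts H"
        then have "nv v = 1" using nv c1 by simp
        then obtain z where "{p'\<in>verts K. f p' = v} = {z}" unfolding nv_def by (rule card_1_singletonE)
        then have "z \<in> {p'\<in>verts K. f p' = v}" by simp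
        then show "v \<in> f ` verts K" by blast
      qed
    qed (fact fV)
  qed
  have Eq: "edges H = ?F ` edges K"
  proof
    show "edges H \<subseteq> ?F ` edges K"
    proof
      fix e assume "e \<in> edges H"
      then have "ne e = 1" using ne c1 by simp
      then obtain z where "{d\<in>edges K. f ` d = e} = {z}" unfolding ne_def by (rule card_1_singletonE)
      then have "z \<in> {d\<in>edges K. f ` d = e}" by simp
      then show "e \<in> ?F ` edges K" by blast
    qed
  qed (use img in auto)
  show ?thesis using hypergraph_isoI[OF bf Eq] sub(1) by blast
qed

end

section \<open>Walks along internal paths\<close>

text \<open>An infinite walk in a finite set repeats a state. Going back from both occurrences along
  the unique predecessors would arrive at a predecessor of \<open>x0\<close>.\<close>

lemma finite_walk_terminates:
  assumes fin: "finite F" and F: "\<And>x y. R x y \<Longrightarrow> x \<in> F"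
    and D: "\<And>x y. R x y \<Longrightarrow> y \<in> D" and x0: "x0 \<in> D"
    and uniq: "\<And>x y z. x \<in> D \<Longrightarrow> y \<in> D \<Longrightarrow> R x z \<Longrightarrow> R y z \<Longrightarrow> x = y"
    and start: "\<And>x. x \<in> D \<Longrightarrow> \<not> R x x0"
  shows "\<exists>y. R\<^sup>*\<^sup>* x0 y \<and> (\<forall>z. \<not> R y z)"
proof (rule ccontr)
  assume "\<not> ?thesis"
  then have ex: "\<exists>z. R y z" if "R\<^sup>*\<^sup>* x0 y" for y using that by blast
  define s where "s = rec_nat x0 (\<lambda>_ x. SOME z. R x z)"
  have s0: "s 0 = x0" and sS: "s (Suc n) = (SOME z. R (s n) z)" for n by (simp_all add: s_def)
  have reach: "R\<^sup>*\<^sup>* x0 (s n)" for n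
  proof (induction n)
    case (Suc n)
    then have "R (s n) (s (Suc n))" unfolding sS using ex someI_ex by metis
    then show ?case using Suc by simp
  qed (simp add: s0)
  have step: "R (s n) (s (Suc n))" for n unfolding sS using ex[OF reach] someI_ex by metis
  have sD: "s n \<in> D" for n
    by (cases n) (use s0 x0 D step in auto)
  have "s i = s j \<Longrightarrow> i = j" for i j
  proof (induction i arbitrary: j)
    case 0
    show ?case
    proof (cases j)
      case (Suc j')
      then show ?thesis using start[OF sD[of j']] step[of j'] 0 s0 by simp
    qed simp
  next
    case (Suc i)
    show ?case
    proof (cases j)
      case 0
      then show ?thesis using start[OF sD[of i]] step[of i] Suc.prems s0 by simp
    next
      case (Suc j')
      then have "s i = s j'" using uniq[OF sD sD] step[of i] step[of j'] Suc.prems by metis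
      then show ?thesis using Suc.IH Suc by simp
    qed
  qed
  then have "inj s" by (simp add: inj_def)
  moreover have "range s \<subseteq> F" using F step by blast
  ultimately show False using fin by (meson finite_imageD finite_subset infinite_UNIV_nat)
qed

lemma obtain_sorted3:
  fixes g :: "'b \<Rightarrow> real"
  assumes "P a b c" "\<And>x y z. P x y z \<Longrightarrow> P y x z" "\<And>x y z. P x y z \<Longrightarrow> P x z y"
  obtains x y z where "P x y z" "g x \<le> g y" "g y \<le> g z"
  using assms by (metis linear)

lemma verts_attach: "verts K \<subseteq> verts (attach v k K)"
  by (auto simp: attach_def Let_def)

context quarter_weighting
begin

lemma partial_cover_edge:
  assumes t: "triple e u v w"
  shows "partial_cover (path_graph 1) ((\<lambda>_. u)(1 := v, 2 := w))
    ((\<lambda>_. {})(0 := inc H u - {e}, 1 := inc H v - {e}, 2 := inc H w - {e}))"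
proof -
  have "e \<in> inc H u" "u \<in> verts H" using triple_inc[OF t] inc_vert by auto
  have "partial_cover (attach 0 1 ({0}, {})) ((\<lambda>_. u)(1 := v, Suc 1 := w))
    (((\<lambda>_. {})(0 := inc H u))(0 := ((\<lambda>_. {})(0 := inc H u)) 0 - {e}, 1 := inc H v - {e}, Suc 1 := inc H w - {e}))"
    using partial_cover_attach_edge[OF partial_cover_vertex[OF \<open>u \<in> verts H\<close>],
      where p = 0 and e = e and a = v and b = w and m = 1] t \<open>e \<in> inc H u\<close> by simp
  then show ?thesis by (simp add: path_graph_eq_attach numeral_2_eq_2)
qed

lemma obtain_attach:
  assumes "partial_cover K f M" "p \<in> verts K" "S \<subseteq> M p" "pendant k (f p) S"
  obtains f' where "partial_cover (attach p k K) f' (M(p := M p - S))" "\<And>q. q \<in> verts K \<Longrightarrow> f' q = f q"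
    "\<And>q. q \<in> verts K \<Longrightarrow> q \<in> verts (attach p k K)"
  using partial_cover_attach[OF assms] verts_attach by blast

lemma partial_cover_done:
  assumes "partial_cover K f M" "\<And>p. M p = {}"
  shows "hypergraph_iso H K"
proof -
  have "M = (\<lambda>_. {})" using assms(2) by auto
  then show ?thesis using partial_cover_complete assms(1) by blast
qed

lemma pendant_1: 
  assumes "e \<in> inc H v" "B v e = 1 / 4" shows "pendant 1 v {e}"
  by (rule pendant_if_short) (use assms in \<open>auto simp: path_weight_def\<close>)

section \<open>Pendant paths around one vertex or one edge\<close>

lemma E_iso:
  assumes v: "v \<in> verts H" and inc: "inc H v = {e1, e2, e3}" "e1 \<noteq> e2" "e1 \<noteq> e3" "e2 \<noteq> e3"
    and p: "pendant i v {e1}" "pendant j v {e2}" "pendant k v {e3}"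
  shows "hypergraph_iso H (E_graph i j k)"
proof -
  let ?M = "(\<lambda>_. {})(0::nat := inc H v)"
  obtain f1 where f1: "partial_cover (attach 0 i ({0}, {})) f1 (?M(0 := ?M 0 - {e1}))"
      "\<And>q. q \<in> verts ({0::nat}, {}::nat set set) \<Longrightarrow> f1 q = v"
    and V1: "0 \<in> verts (attach 0 i ({0}, {}))"
    by (rule obtain_attach[OF partial_cover_vertex[OF v], of 0 "{e1}" i]) (use p inc in auto)
  have a0: "f1 0 = v" using f1(2) by simp
  obtain f2 where f2: "partial_cover (attach 0 j (attach 0 i ({0}, {}))) f2 (?M(0 := ?M 0 - {e1} - {e2}))"
      "f2 0 = f1 0"
    and V2: "0 \<in> verts (attach 0 j (attach 0 i ({0}, {})))"
    by (rule obtain_attach[OF f1(1) V1, of "{e2}" j]) (use p inc a0 V1 in auto)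
  obtain f3 where f3: "partial_cover (E_graph i j k) f3 (?M(0 := ?M 0 - {e1} - {e2} - {e3}))"
    unfolding E_graph_def
    by (rule obtain_attach[OF f2(1) V2, of "{e3}" k]) (use p inc f2 a0 in auto)
  then show ?thesis by (rule partial_cover_done) (use inc in auto)
qed

lemma S4_iso:
  assumes v: "v \<in> verts H" and inc: "inc H v = {e1, e2, e3, e4}" "distinct [e1, e2, e3, e4]"
    and p: "pendant 1 v {e1}" "pendant 1 v {e2}" "pendant 1 v {e3}" "pendant 1 v {e4}"
  shows "hypergraph_iso H S4_graph"
proof -
  let ?M = "(\<lambda>_. {})(0::nat := inc H v)"
  let ?K1 = "attach 0 1 ({0}, {})"
  let ?K2 = "attach 0 1 ?K1"
  let ?K3 = "attach 0 1 ?K2"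
  let ?K4 = "attach 0 1 ?K3"
  obtain f1 where f1: "partial_cover ?K1 f1 (?M(0 := ?M 0 - {e1}))"
      "\<And>q. q \<in> verts ({0::nat}, {}::nat set set) \<Longrightarrow> f1 q = v" and V1: "0 \<in> verts ?K1"
    by (rule obtain_attach[OF partial_cover_vertex[OF v], of 0 "{e1}" 1]) (use p inc in auto)
  have a0: "f1 0 = v" using f1(2) by simp
  obtain f2 where f2: "partial_cover ?K2 f2 (?M(0 := ?M 0 - {e1} - {e2}))"
      "f2 0 = f1 0" and V2: "0 \<in> verts ?K2"
    by (rule obtain_attach[OF f1(1) V1, of "{e2}" 1]) (use p inc a0 V1 in auto)
  obtain f3 where f3: "partial_cover ?K3 f3 (?M(0 := ?M 0 - {e1} - {e2} - {e3}))"
      "f3 0 = f2 0" and V3: "0 \<in> verts ?K3"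
    by (rule obtain_attach[OF f2(1) V2, of "{e3}" 1]) (use p inc f2 a0 V2 in auto)
  obtain f4 where f4: "partial_cover ?K4 f4 (?M(0 := ?M 0 - {e1} - {e2} - {e3} - {e4}))"
    by (rule obtain_attach[OF f3(1) V3, of "{e4}" 1]) (use p inc f2 f3 a0 in auto)
  \<comment> \<open>\<open>S4_graph\<close> is listed explicitly instead of being built by
    \<open>attach\<close>, so the numbering is computed edge by edge.\<close>
  have S: "?K4 = S4_graph"
  proof -
    have 1: "?K1 = ({0, 1, 2}, {{0, 1, 2}})"
      by (simp add: attach_one Let_def insert_commute eval_nat_numeral)
    have 2: "?K2 = ({0, 1, 2, 3, 4}, {{0, 1, 2}, {0, 3, 4}})"
      unfolding 1 by (simp add: attach_one Let_def insert_commute eval_nat_numeral)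
    have 3: "?K3 = ({0, 1, 2, 3, 4, 5, 6}, {{0, 1, 2}, {0, 3, 4}, {0, 5, 6}})"
      unfolding 2 by (simp add: attach_one Let_def insert_commute eval_nat_numeral)
    have "?K4 = ({0, 1, 2, 3, 4, 5, 6, 7, 8}, {{0, 1, 2}, {0, 3, 4}, {0, 5, 6}, {0, 7, 8}})"
      unfolding 3 by (simp add: attach_one Let_def insert_commute eval_nat_numeral)
    moreover have "{0, 1, 2, 3, 4, 5, 6, 7, 8} = {0..8::nat}" by auto
    ultimately show ?thesis by (simp add: S4_graph_def)
  qed
  show ?thesis unfolding S[symmetric]
    by (rule partial_cover_done[OF f4]) (use inc in auto)
qed

lemma F_iso:
  assumes t: "triple e u v w"
    and p: "pendant i u (inc H u - {e})" "pendant j v (inc H v - {e})" "pendant k w (inc H w - {e})"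
  shows "hypergraph_iso H (F_graph i j k)"
proof -
  let ?M = "(\<lambda>_. {})(0::nat := inc H u - {e}, 1 := inc H v - {e}, 2 := inc H w - {e})"
  let ?f = "(\<lambda>_. u)(1 := v, 2 := w)"
  have K: "path_graph 1 = ({0, 1, 2}, {{0, 1, 2}})"
    by (auto simp: path_graph_def path_edge_def)
  note K' = K[unfolded One_nat_def]
  note c = partial_cover_edge[OF t]
  obtain f1 where f1: "partial_cover (attach 0 i (path_graph 1)) f1 (?M(0 := ?M 0 - (inc H u - {e})))"
      "f1 1 = v" "f1 2 = w" and V1: "1 \<in> verts (attach 0 i (path_graph 1))" "2 \<in> verts (attach 0 i (path_graph 1))"
    by (rule obtain_attach[OF c, of 0 "inc H u - {e}" i]) (use p in \<open>auto simp: K'\<close>)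
  obtain f2 where f2: "partial_cover (attach 1 j (attach 0 i (path_graph 1))) f2
      (?M(0 := ?M 0 - (inc H u - {e}), 1 := ?M 1 - (inc H v - {e})))"
      "f2 2 = w" and V2: "2 \<in> verts (attach 1 j (attach 0 i (path_graph 1)))"
    by (rule obtain_attach[OF f1(1) V1(1), of "inc H v - {e}" j]) (use p f1 V1 in auto)
  obtain f3 where f3: "partial_cover (F_graph i j k) f3
      (?M(0 := ?M 0 - (inc H u - {e}), 1 := ?M 1 - (inc H v - {e}), 2 := ?M 2 - (inc H w - {e})))"
    unfolding F_graph_def K[symmetric]
    by (rule obtain_attach[OF f2(1) V2, of "inc H w - {e}" k]) (use p f2 in auto)
  show ?thesis by (rule partial_cover_done[OF f3]) auto
qed

text \<open>A pair \<open>(v, e)\<close> stands for a walk that has arrived at \<open>v\<close> and continues along \<open>e\<close>; a step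
  exists only as long as the continuation is forced. Every pair has at most one predecessor whose
  vertex is not a leaf, so a walk that starts at a pair without one ends.\<close>

definition walk_step :: "'a \<times> 'a set \<Rightarrow> 'a \<times> 'a set \<Rightarrow> bool" where
  "walk_step = (\<lambda>(v, e) (b, d). (\<exists>a. triple e v a b \<and> leaf a e) \<and> inc H b = {e, d} \<and> d \<noteq> e)"

text \<open>The leaf edge \<open>e\<close> gives \<open>B b e = 1 / (4 * B v e)\<close>, and
  \<open>d\<close> is all that remains at \<open>b\<close>.\<close>

lemma walk_step_weight:
  assumes "walk_step (v, e) (b, d)"
  shows "B b d = 1 - 1 / (4 * B v e)"
proof -
  obtain a where t: "triple e v a b" and l: "leaf a e" and i: "inc H b = {e, d}" "d \<noteq> e"
    using assms by (auto simp: walk_step_def)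
  have "B v e * B b e = 1 / 4" by (rule leaf_edge_weight[OF t l])
  moreover have "B v e > 0" using triple_inc[OF t] B_pos' by auto
  moreover have "inc H b - {e} = {d}" using i by auto
  then have "B b d = 1 - B b e" using W_complement[OF triple_inc(3)[OF t]] by simp
  moreover have "B b e = 1 / (4 * B v e)" using calculation(1,2) by (simp add: field_simps)
  ultimately show ?thesis by simp
qed

text \<open>\<open>M\<close> records what stays open for later, and \<open>e\<close> is the one
  additional open edge at the end of the path. Since \<open>e\<close> is not in
  \<open>M (2 * j)\<close>, crossing it restores \<open>M\<close> there exactly, and only the two
  new vertices bring open edges.\<close>

lemma partial_cover_extend:
  assumes pc: "partial_cover (path_graph j) f (M(2 * j := insert e (M (2 * j))))" and e: "e \<notin> M (2 * j)"
    and M: "\<And>q. q > 2 * j \<Longrightarrow> M q = {}" and t: "triple e (f (2 * j)) a b"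
  shows "partial_cover (path_graph (Suc j)) (f(2 * j + 1 := a, 2 * j + 2 := b))
      (M(2 * j + 1 := inc H a - {e}, 2 * j + 2 := inc H b - {e}))"
proof -
  have "partial_cover (attach (2 * j) 1 (path_graph j)) (f(2 * j + 1 := a, Suc (2 * j + 1) := b))
      ((M(2 * j := insert e (M (2 * j))))(2 * j := (M(2 * j := insert e (M (2 * j)))) (2 * j) - {e},
        2 * j + 1 := inc H a - {e}, Suc (2 * j + 1) := inc H b - {e}))"
    using t by (intro partial_cover_attach_edge[OF pc]) (auto simp: Max_path_graph, auto simp: path_graph_def)
  moreover have "(M(2 * j := insert e (M (2 * j))))(2 * j := (M(2 * j := insert e (M (2 * j)))) (2 * j) - {e}) = M"
    using e by auto
  ultimately show ?thesis by (simp add: attach_path_graph)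
qed

text \<open>\<open>start\<close> keeps the walk from closing up at its first state, so it stops. The
  cover of the path read so far leaves the edges in \<open>M\<close> open and carries the weight
  \<open>w n\<close> to the end; the shape of \<open>H\<close> there is left to the
  application.\<close>

lemma walk_along_path:
  assumes pc: "partial_cover (path_graph k) f (M(2 * k := insert e (M (2 * k))))" and eM: "e \<notin> M (2 * k)"
    and M: "\<And>q. q > 2 * k \<Longrightarrow> M q = {}"
    and e: "e \<in> inc H (f (2 * k))" "\<not> leaf (f (2 * k)) e"
    and start: "\<And>v d. walk_step (v, d) (f (2 * k), e) \<Longrightarrow> leaf v d"
    and w: "B (f (2 * k)) e = w 0" "\<And>n. w (Suc n) = 1 - 1 / (4 * w n)"
  obtains n g d where "partial_cover (path_graph (k + n)) g (M(2 * (k + n) := insert d (M (2 * (k + n)))))"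
    "d \<notin> M (2 * (k + n))" "\<And>q. q \<le> 2 * k \<Longrightarrow> g q = f q"
    "d \<in> inc H (g (2 * (k + n)))" "B (g (2 * (k + n))) d = w n" "\<And>x. \<not> walk_step (g (2 * (k + n)), d) x"
proof -
  define D where "D = {(v, d). \<not> leaf v d}"
  have wt: "(\<exists>a. triple (snd x) (fst x) a (fst y) \<and> leaf a (snd x)) \<and> inc H (fst y) = {snd x, snd y} \<and> snd y \<noteq> snd x"
    if "walk_step x y" for x y using that by (auto simp: walk_step_def split: prod.splits)
  obtain y where y: "walk_step\<^sup>*\<^sup>* (f (2 * k), e) y" "\<And>z. \<not> walk_step y z"
  proof (atomize_elim, rule finite_walk_terminates[of "verts H \<times> edges H" walk_step D "(f (2 * k), e)"])
    show "finite (verts H \<times> edges H)" using finite_verts finite_edges by simp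
    show "x \<in> verts H \<times> edges H" if "walk_step x y" for x y
      using wt[OF that] edge_sub by (cases x) (auto simp: triple_def)
    show "y \<in> D" if "walk_step x y" for x y
      using wt[OF that] by (cases y) (auto simp: D_def)
    show "(f (2 * k), e) \<in> D" using e by (simp add: D_def)
    show "\<not> walk_step x (f (2 * k), e)" if "x \<in> D" for x
      using start that by (cases x) (auto simp: D_def)
    show "x = y" if D: "x \<in> D" "y \<in> D" and s: "walk_step x z" "walk_step y z" for x y z
    proof -
      obtain v d v' d' b c where xyz: "x = (v, d)" "y = (v', d')" "z = (b, c)" by (metis surj_pair)
      obtain a a' where t: "triple d v a b" "leaf a d" "triple d' v' a' b" "leaf a' d'"
        and i: "inc H b = {d, c}" "c \<noteq> d" "inc H b = {d', c}" "c \<noteq> d'"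
        using wt[OF s(1)] wt[OF s(2)] xyz by auto
      have "d' = d" using i by auto
      \<comment> \<open>Besides \<open>b\<close> the edge \<open>d\<close> has two vertices, one of
        which is the leaf \<open>a\<close>, while states in \<open>D\<close> have no leaf as
        vertex.\<close>
      moreover have "v' = v"
      proof -
        have "v' \<in> d'" "v' \<noteq> b" "d = {v, a, b}" using t(1,3) unfolding triple_def by blast+
        moreover have "v' \<noteq> a" using D(2) t(2) xyz \<open>d' = d\<close> by (auto simp: D_def)
        ultimately show ?thesis using \<open>d' = d\<close> by blast
      qed
      ultimately show ?thesis using xyz by simp
    qed
  qed
  have "\<exists>n g. partial_cover (path_graph (k + n)) g (M(2 * (k + n) := insert (snd y) (M (2 * (k + n))))) \<and>
    snd y \<notin> M (2 * (k + n)) \<and> (\<forall>q\<le>2 * k. g q = f q) \<and>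
    snd y \<in> inc H (fst y) \<and> g (2 * (k + n)) = fst y \<and> B (fst y) (snd y) = w n"
    using y(1)
  proof (induction rule: rtranclp_induct)
    case base
    show ?case using pc eM e w(1) by (intro exI[of _ 0] exI[of _ f]) (simp del: fun_upd_apply)
  next
    case (step y z)
    obtain v d b c where yz: "y = (v, d)" "z = (b, c)" by (metis surj_pair)
    obtain n g where g: "partial_cover (path_graph (k + n)) g (M(2 * (k + n) := insert d (M (2 * (k + n)))))"
      "d \<notin> M (2 * (k + n))" "\<forall>q\<le>2 * k. g q = f q" "g (2 * (k + n)) = v" "B v d = w n"
      using step.IH yz by (auto simp del: fun_upd_apply)
    obtain a where t: "triple d v a b" "leaf a d" and i: "inc H b = {d, c}" "c \<noteq> d"
      using wt[OF step.hyps(2)] yz by auto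
    let ?j = "k + n"
    let ?g = "g(2 * ?j + 1 := a, 2 * ?j + 2 := b)"
    have "partial_cover (path_graph (Suc ?j)) ?g (M(2 * ?j + 1 := inc H a - {d}, 2 * ?j + 2 := inc H b - {d}))"
      by (rule partial_cover_extend[OF g(1,2)]) (use M t g(4) in auto)
    moreover have "M(2 * ?j + 1 := inc H a - {d}, 2 * ?j + 2 := inc H b - {d}) =
        M(2 * (k + Suc n) := insert c (M (2 * (k + Suc n))))"
      using M t i by (intro ext) auto
    moreover have M2: "M (2 * (k + Suc n)) = {}" using M by simp
    ultimately have "partial_cover (path_graph (k + Suc n)) ?g (M(2 * (k + Suc n) := insert c (M (2 * (k + Suc n)))))"
      by (simp only: add_Suc_right)
    moreover have "?g (2 * (k + Suc n)) = b" by simp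
    moreover have "\<forall>q\<le>2 * k. ?g q = f q" using g(3) by simp
    moreover have "B b c = w (Suc n)"
      using walk_step_weight[of v d b c] step.hyps(2) yz g(5) w(2) by simp
    moreover have "c \<in> inc H b" using i by simp
    ultimately show ?case using M2 yz
      by (intro exI[of _ "Suc n"] exI[of _ ?g]) (simp del: fun_upd_apply)
  qed
  then obtain n g where "partial_cover (path_graph (k + n)) g (M(2 * (k + n) := insert (snd y) (M (2 * (k + n)))))"
    "snd y \<notin> M (2 * (k + n))" "\<forall>q\<le>2 * k. g q = f q"
    "snd y \<in> inc H (fst y)" "g (2 * (k + n)) = fst y" "B (fst y) (snd y) = w n" by blast
  then show thesis using that[of n g "snd y"] y(2) by simp
qed


declare pendant.simps [simp del]

section \<open>Ends of forced walks and families of unbounded length\<close>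

lemma two_edges:
  assumes "e \<in> inc H v" "\<not> leaf v e" "card (inc H v) \<le> 2"
  obtains d where "inc H v = {e, d}" "d \<noteq> e"
proof -
  obtain d where d: "d \<in> inc H v" "d \<noteq> e" using assms by blast
  have "{e, d} = inc H v"
    using assms d finite_inc by (intro card_seteq) auto
  then show thesis using that d by blast
qed

text \<open>The other two weights multiply to \<open>1 / 2\<close> and are at most
  \<open>3 / 4\<close>, so both are at least \<open>2 / 3\<close>; the admissible values in that
  range are \<open>2 / 3\<close> and \<open>3 / 4\<close> only.\<close>

lemma half_split:
  assumes t: "triple d v a b" and v: "B v d = 1 / 2" and nl: "\<not> leaf a d" "\<not> leaf b d"
  shows "B a d = 3 / 4 \<and> B b d = 2 / 3 \<or> B a d = 2 / 3 \<and> B b d = 3 / 4"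
proof -
  note i = triple_inc[OF t]
  have p: "B a d * B b d = 1 / 2" using triple_prod[OF t] v by simp
  have ab: "B a d \<le> 3/4" "B b d \<le> 3/4" "B a d > 0" "B b d > 0"
    using nonleaf_le i B_pos' nl by auto
  have "B a d * (3/4) \<ge> B a d * B b d" "3/4 * B b d \<ge> B a d * B b d"
    using ab by (intro mult_left_mono mult_right_mono; simp)+
  then have "B a d \<ge> 2/3" "B b d \<ge> 2/3" using p by auto
  then have "B a d \<in> {3/4, 2/3}" "B b d \<in> {3/4, 2/3}"
    using B_cases[OF i(2)] B_cases[OF i(3)] ab by auto
  moreover have "x = 3 / 4 \<and> y = 2 / 3 \<or> x = 2 / 3 \<and> y = 3 / 4"
    if "x \<in> {3/4, 2/3}" "y \<in> {3/4, 2/3}" "x * y = 1 / 2" for x y :: real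
    using that by (elim insertE emptyE; hypsubst; simp)
  ultimately show ?thesis using p by blast
qed

lemma pendant_complement:
  assumes "d \<in> inc H a" "1 - B a d = path_weight k" "k \<le> 7"
  shows "pendant k a (inc H a - {d})"
  using assms by (intro pendant_if_short) (auto simp: W_complement)

text \<open>The end that \<open>B_tilde\<close> and \<open>BD_tilde\<close> have in common: a walk
  of weight \<open>1 / 2\<close> stopped by an edge without a leaf ahead.\<close>

lemma half_end:
  assumes d: "d \<in> inc H v" "B v d = 1 / 2" and nl: "\<And>a b. triple d v a b \<Longrightarrow> \<not> leaf a d \<and> \<not> leaf b d"
  obtains a b where "triple d v a b" "pendant 1 a (inc H a - {d})" "pendant 2 b (inc H b - {d})"
proof -
  obtain a' b' where t': "triple d v a' b'" by (rule obtain_triple[of d v]) (use d(1) in \<open>auto simp: inc_iff\<close>)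
  then obtain a b where t: "triple d v a b" and B: "B a d = 3/4" "B b d = 2/3"
    using half_split[OF t' d(2)] nl[OF t'] triple_swap[OF t'] by metis
  show thesis
    by (rule that[OF t]; rule pendant_complement) (use triple_inc[OF t] B in \<open>auto simp: path_weight_def\<close>)
qed

text \<open>The weight \<open>1 / 2\<close> of \<open>e3\<close> is the fixed point, so it persists
  along the walk. The walk stops at a second vertex of degree 3, giving \<open>D_tilde\<close>, or
  at an edge without a leaf ahead, giving \<open>BD_tilde\<close>.\<close>

lemma D_case:
  assumes inc: "inc H v = {e1, e2, e3}" "e1 \<noteq> e2" "e1 \<noteq> e3" "e2 \<noteq> e3"
    and B: "B v e1 = 1 / 4" "B v e2 = 1 / 4" "B v e3 = 1 / 2"
  shows "(\<exists>n\<ge>5. hypergraph_iso H (D_tilde n)) \<or> (\<exists>n\<ge>6. hypergraph_iso H (BD_tilde n))"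
proof -
  have p1: "pendant 1 v {e1}" and p2: "pendant 1 v {e2}" using pendant_1 inc B by auto
  then obtain a b where t: "triple e1 v a b" and l: "leaf a e1" "inc H b - {e1} = {}"
    by (auto simp: pendant.simps)
  \<comment> \<open>The path is read with \<open>e1\<close> as its first edge and \<open>v\<close>
    as vertex 2, where \<open>e2\<close> stays open as the later pendant edge.\<close>
  define f where "f = ((\<lambda>_::nat. a)(1 := b, 2 := v))"
  define M :: "nat \<Rightarrow> 'a set set" where "M = (\<lambda>_. {})(2 := {e2})"
  have M0: "(\<lambda>_. {})(0::nat := inc H a - {e1}, 1 := inc H b - {e1}, 2 := inc H v - {e1}) =
      M(2 * 1 := insert e3 (M (2 * 1)))"
    using l inc by (auto simp: M_def fun_eq_iff)
  have pc: "partial_cover (path_graph 1) f (M(2 * 1 := insert e3 (M (2 * 1))))"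
    using partial_cover_edge[OF triple_rot[OF t]] unfolding M0 f_def .
  obtain n g d where g: "partial_cover (path_graph (1 + n)) g (M(2 * (1 + n) := insert d (M (2 * (1 + n)))))"
    "d \<notin> M (2 * (1 + n))" "\<And>q. q \<le> 2 * 1 \<Longrightarrow> g q = f q"
    "d \<in> inc H (g (2 * (1 + n)))" "B (g (2 * (1 + n))) d = 1 / 2" "\<And>x. \<not> walk_step (g (2 * (1 + n)), d) x"
  proof (rule walk_along_path[OF pc, where w = "\<lambda>_. 1 / 2"])
    show "\<not> leaf (f (2 * 1)) e3" using inc by (auto simp: f_def)
    show "leaf v' d" if s: "walk_step (v', d) (f (2 * 1), e3)" for v' d
    proof -
      have "inc H v = {d, e3}" using s by (simp add: walk_step_def f_def)
      then have "card (inc H v) \<le> 2" by (simp add: card_insert_if)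
      moreover have "card (inc H v) = 3" using inc by simp
      ultimately show ?thesis by simp
    qed
  qed (use inc B in \<open>auto simp: f_def M_def\<close>)
  let ?j = "Suc n"
  define u where "u = g (2 * ?j)"
  have g2: "g 2 = v" using g(3)[of 2] by (simp add: f_def)
  have d: "d \<in> inc H u" "B u d = 1 / 2" and stop: "\<And>x. \<not> walk_step (u, d) x"
    using g(4-6) by (simp_all add: u_def)
  have ext: "partial_cover (path_graph (Suc ?j)) (g(2 * ?j + 1 := a, 2 * ?j + 2 := b))
      (M(2 * ?j + 1 := inc H a - {d}, 2 * ?j + 2 := inc H b - {d}))" if t: "triple d u a b" for a b
  proof (rule partial_cover_extend)
    show "partial_cover (path_graph ?j) g (M(2 * ?j := insert d (M (2 * ?j))))" using g(1) by simp
    show "triple d (g (2 * ?j)) a b" using t by (simp add: u_def)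
  qed (use g(2) in \<open>auto simp: M_def\<close>)
  have V: "q \<in> verts (path_graph k) \<longleftrightarrow> q \<le> 2 * k" for q k by (simp add: path_graph_def)
  show ?thesis
  proof (cases "\<exists>a b. triple d u a b \<and> leaf a d")
    case True
    then obtain a b where t: "triple d u a b" and l: "leaf a d" by blast
    have ib: "d \<in> inc H b" by (rule triple_inc[OF t])
    have Bb: "B b d = 1 / 2" using leaf_edge_weight[OF t l] d(2) by simp
    define S where "S = inc H b - {d}"
    have S: "S \<subseteq> inc H b" and W: "W b S = 1 / 2" using W_complement[OF ib] Bb by (auto simp: S_def)
    have finS: "finite S" using S finite_inc finite_subset by blast
    \<comment> \<open>A single further edge would be a forced step. So the edges beyond
      \<open>d\<close>, of total weight \<open>1 / 2\<close>, are two of weight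
      \<open>1 / 4\<close>.\<close>
    have "card S \<noteq> 1"
    proof
      assume "card S = 1"
      then obtain c where "S = {c}" by (rule card_1_singletonE)
      then have "walk_step (u, d) (b, c)" using t l ib by (auto simp: walk_step_def S_def)
      then show False using stop by blast
    qed
    moreover have "card S \<le> 2" using W_ge_card[OF S] W by simp
    moreover have "card S \<noteq> 0" using W finS by auto
    ultimately have "card S = 2" by linarith
    then obtain d1 d2 where d12: "S = {d1, d2}" "d1 \<noteq> d2" by (meson card_2_iff)
    then have "B b d1 + B b d2 = 1 / 2" using W by (simp add: W_def)
    then have "B b d1 = 1 / 4" "B b d2 = 1 / 4" using B_ge[of d1 b] B_ge[of d2 b] S d12 by auto
    then have p: "pendant 1 b {d1}" "pendant 1 b {d2}" using pendant_1 S d12 by auto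
    let ?q = "2 * Suc ?j"
    define M1 where "M1 = M(?q := {d1, d2})"
    have M1: "M(2 * ?j + 1 := inc H a - {d}, 2 * ?j + 2 := inc H b - {d}) = M1"
      using l d12 by (auto simp: M1_def M_def S_def fun_eq_iff)
    note pc1 = ext[OF t, unfolded M1]
    let ?g1 = "g(2 * ?j + 1 := a, 2 * ?j + 2 := b)"
    obtain g2 where pc2: "partial_cover (attach ?q 1 (path_graph (Suc ?j))) g2 (M1(?q := M1 ?q - {d1}))"
      and eq2: "\<And>q. q \<in> verts (path_graph (Suc ?j)) \<Longrightarrow> g2 q = ?g1 q"
      by (rule obtain_attach[OF pc1, of ?q "{d1}" 1]) (use p in \<open>auto simp: V M1_def\<close>)
    \<comment> \<open>\<open>d1\<close> prolongs the path to \<open>n + 3\<close> edges, and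
      \<open>d2\<close> becomes the pendant edge at its last joint; together with \<open>e2\<close>
      there are \<open>n + 5\<close> edges.\<close>
    have K2: "attach ?q 1 (path_graph (Suc ?j)) = path_graph (n + 3)"
      by (subst attach_path_graph) (simp add: numeral_3_eq_3)
    note pc2 = pc2[unfolded K2]
    have g2v: "g2 2 = v" "g2 ?q = b" using eq2[of 2] eq2[of ?q] \<open>g 2 = v\<close> by (auto simp: V)
    obtain g3 where pc3: "partial_cover (attach 2 1 (path_graph (n + 3))) g3
        (M1(?q := M1 ?q - {d1}, 2 := (M1(?q := M1 ?q - {d1})) 2 - {e2}))"
      and eq3: "\<And>q. q \<in> verts (path_graph (n + 3)) \<Longrightarrow> g3 q = g2 q"
      and V3: "\<And>q. q \<in> verts (path_graph (n + 3)) \<Longrightarrow> q \<in> verts (attach 2 1 (path_graph (n + 3)))"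
      by (rule obtain_attach[OF pc2, of 2 "{e2}" 1]) (use p2 g2v in \<open>auto simp: V M1_def M_def\<close>)
    have g3: "g3 ?q = b" "?q \<in> verts (attach 2 1 (path_graph (n + 3)))"
      using eq3[of ?q] V3[of ?q] g2v by (auto simp: V)
    obtain g4 where pc4: "partial_cover (attach ?q 1 (attach 2 1 (path_graph (n + 3)))) g4
        ((M1(?q := M1 ?q - {d1}, 2 := (M1(?q := M1 ?q - {d1})) 2 - {e2}))
          (?q := (M1(?q := M1 ?q - {d1}, 2 := (M1(?q := M1 ?q - {d1})) 2 - {e2})) ?q - {d2}))"
      by (rule obtain_attach[OF pc3 g3(2), of "{d2}" 1]) (use p d12 g3 in \<open>auto simp: M1_def M_def\<close>)
    then have "hypergraph_iso H (attach ?q 1 (attach 2 1 (path_graph (n + 3))))"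
      by (rule partial_cover_done) (auto simp: M1_def M_def)
    then have "hypergraph_iso H (D_tilde (n + 5))" by (simp add: D_tilde_def add.commute)
    then show ?thesis by (meson le_add2)
  next
    case False
    have nl: "\<not> leaf a d \<and> \<not> leaf b d" if t: "triple d u a b" for a b
      using False t triple_swap[OF t] by blast
    obtain a b where t: "triple d u a b" and p: "pendant 1 a (inc H a - {d})" "pendant 2 b (inc H b - {d})"
      by (rule half_end[OF d nl])
    let ?q = "2 * Suc ?j"
    define M1 where "M1 = M(2 * ?j + 1 := inc H a - {d}, ?q := inc H b - {d})"
    have M1: "M(2 * ?j + 1 := inc H a - {d}, 2 * ?j + 2 := inc H b - {d}) = M1"
      by (simp add: M1_def)
    note pc1 = ext[OF t, unfolded M1]
    let ?g1 = "g(2 * ?j + 1 := a, 2 * ?j + 2 := b)"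
    obtain g2 where pc2: "partial_cover (attach ?q 2 (path_graph (Suc ?j))) g2 (M1(?q := M1 ?q - (inc H b - {d})))"
      and eq2: "\<And>q. q \<in> verts (path_graph (Suc ?j)) \<Longrightarrow> g2 q = ?g1 q"
      by (rule obtain_attach[OF pc1, of ?q "inc H b - {d}" 2]) (use p in \<open>auto simp: V M1_def\<close>)
    \<comment> \<open>The pendant path of length 2 at \<open>b\<close> completes a path of
      \<open>n + 4\<close> edges; the pendant edge at \<open>a\<close> then hangs on the third last
      of them.\<close>
    have K2: "attach ?q 2 (path_graph (Suc ?j)) = path_graph (n + 4)"
      by (subst attach_path_graph) (simp add: eval_nat_numeral)
    note pc2 = pc2[unfolded K2]
    let ?M2 = "M1(?q := M1 ?q - (inc H b - {d}))"
    have g2v: "g2 2 = v" "g2 (2 * ?j + 1) = a" using eq2[of 2] eq2[of "2 * ?j + 1"] \<open>g 2 = v\<close> by (auto simp: V)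
    obtain g3 where pc3: "partial_cover (attach 2 1 (path_graph (n + 4))) g3 (?M2(2 := ?M2 2 - {e2}))"
      and eq3: "\<And>q. q \<in> verts (path_graph (n + 4)) \<Longrightarrow> g3 q = g2 q"
      and V3: "\<And>q. q \<in> verts (path_graph (n + 4)) \<Longrightarrow> q \<in> verts (attach 2 1 (path_graph (n + 4)))"
      by (rule obtain_attach[OF pc2, of 2 "{e2}" 1]) (use p2 g2v in \<open>auto simp: V M1_def M_def\<close>)
    let ?M3 = "?M2(2 := ?M2 2 - {e2})"
    have g3: "g3 (2 * ?j + 1) = a" "2 * ?j + 1 \<in> verts (attach 2 1 (path_graph (n + 4)))"
      using eq3[of "2 * ?j + 1"] V3[of "2 * ?j + 1"] g2v by (auto simp: V)
    obtain g4 where pc4: "partial_cover (attach (2 * ?j + 1) 1 (attach 2 1 (path_graph (n + 4)))) g4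
        (?M3(2 * ?j + 1 := ?M3 (2 * ?j + 1) - (inc H a - {d})))"
      by (rule obtain_attach[OF pc3 g3(2), of "inc H a - {d}" 1]) (use p g3 in \<open>auto simp: M1_def M_def\<close>)
    then have "hypergraph_iso H (attach (2 * ?j + 1) 1 (attach 2 1 (path_graph (n + 4))))"
      by (rule partial_cover_done) (auto simp: M1_def M_def)
    then have "hypergraph_iso H (BD_tilde (n + 6))" by (simp add: BD_tilde_def add.commute)
    then show ?thesis by (meson le_add2)
  qed
qed

text \<open>As \<open>w n\<close> is never \<open>1 / 4\<close>, the weight across an edge with a
  leaf is never 1, so the walk does not run into a leaf, and by \<open>deg\<close> its next step is
  forced. It can stop only at an edge whose two vertices ahead are no leaves, the other end of a
  \<open>G_graph\<close>.\<close>

lemma G_walk: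
  assumes deg: "\<And>v. card (inc H v) \<le> 2"
    and t: "triple e u v x" and nl: "\<not> leaf u e" "\<not> leaf v e"
    and x: "inc H x = {e, e0}" "e0 \<noteq> e"
    and p: "pendant i u (inc H u - {e})" "pendant j v (inc H v - {e})"
    and w: "B x e0 = w 0" "\<And>n. w (Suc n) = 1 - 1 / (4 * w n)" "\<And>n. w n \<noteq> 1 / 4"
  obtains n y d where "d \<in> inc H y" "B y d = w n"
    "\<And>a b. triple d y a b \<Longrightarrow> \<not> leaf a d \<and> \<not> leaf b d"
    "\<And>a b l m. triple d y a b \<Longrightarrow> pendant l a (inc H a - {d}) \<Longrightarrow> pendant m b (inc H b - {d}) \<Longrightarrow>
       hypergraph_iso H (G_graph i j n l m)"
proof -
  define f where "f = ((\<lambda>_::nat. u)(1 := v, 2 := x))"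
  define M :: "nat \<Rightarrow> 'a set set" where "M = (\<lambda>_. {})(0 := inc H u - {e}, 1 := inc H v - {e})"
  have M0: "(\<lambda>_. {})(0::nat := inc H u - {e}, 1 := inc H v - {e}, 2 := inc H x - {e}) =
      M(2 * 1 := insert e0 (M (2 * 1)))"
    using x by (auto simp: M_def fun_eq_iff)
  have pc: "partial_cover (path_graph 1) f (M(2 * 1 := insert e0 (M (2 * 1))))"
    using partial_cover_edge[OF t] unfolding M0 f_def .
  obtain n g d where g: "partial_cover (path_graph (1 + n)) g (M(2 * (1 + n) := insert d (M (2 * (1 + n)))))"
    "d \<notin> M (2 * (1 + n))" "\<And>q. q \<le> 2 * 1 \<Longrightarrow> g q = f q"
    "d \<in> inc H (g (2 * (1 + n)))" "B (g (2 * (1 + n))) d = w n" "\<And>x. \<not> walk_step (g (2 * (1 + n)), d) x"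
  proof (rule walk_along_path[OF pc, where w = w])
    show "\<not> leaf (f (2 * 1)) e0" using x by (auto simp: f_def)
    show "leaf v' d" if s: "walk_step (v', d) (f (2 * 1), e0)" for v' d
    proof -
      obtain a where a: "triple d v' a x" "leaf a d" and i: "inc H x = {d, e0}" "e0 \<noteq> d"
        using s by (auto simp: walk_step_def f_def)
      \<comment> \<open>A step into \<open>x\<close> would have to cross \<open>e\<close>, whose
        leaf would then be \<open>u\<close> or \<open>v\<close>.\<close>
      have "d = e" using i x by auto
      moreover have "a \<in> d" "a \<noteq> x" "e = {u, v, x}" using a(1) t unfolding triple_def by blast+
      ultimately have "a = u \<or> a = v" by blast
      then show ?thesis using a(2) nl \<open>d = e\<close> by blast
    qed
  qed (use x w in \<open>auto simp: f_def M_def\<close>)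
  let ?j = "Suc n"
  define y where "y = g (2 * ?j)"
  have d: "d \<in> inc H y" "B y d = w n" and stop: "\<And>x. \<not> walk_step (y, d) x"
    using g(4-6) by (simp_all add: y_def)
  have V: "q \<in> verts (path_graph k) \<longleftrightarrow> q \<le> 2 * k" for q k by (simp add: path_graph_def)
  have leaf: "\<not> leaf a d" if t: "triple d y a b" for a b
  proof
    assume l: "leaf a d"
    note ib = triple_inc(3)[OF t]
    have "B y d * B b d = 1 / 4" by (rule leaf_edge_weight[OF t l])
    then have nl: "\<not> leaf b d" using d(2) w(3)[of n] B_eq_1[OF ib] by auto
    obtain c where "inc H b = {d, c}" "c \<noteq> d" by (rule two_edges[OF ib nl deg])
    then have "walk_step (y, d) (b, c)" using t l by (auto simp: walk_step_def)
    then show False using stop by blast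
  qed
  show thesis
  proof (rule that[OF d])
    show "\<not> leaf a d \<and> \<not> leaf b d" if t: "triple d y a b" for a b
      using leaf[OF t] leaf[OF triple_swap[OF t]] by blast
    fix a b l m assume t: "triple d y a b"
      and q: "pendant l a (inc H a - {d})" "pendant m b (inc H b - {d})"
    let ?a = "2 * n + 3" and ?b = "2 * n + 4"
    let ?S = "inc H u - {e}" and ?T = "inc H v - {e}" and ?A = "inc H a - {d}" and ?B = "inc H b - {d}"
    have "partial_cover (path_graph (Suc ?j)) (g(2 * ?j + 1 := a, 2 * ?j + 2 := b))
        (M(2 * ?j + 1 := inc H a - {d}, 2 * ?j + 2 := inc H b - {d}))"
    proof (rule partial_cover_extend)
      show "partial_cover (path_graph ?j) g (M(2 * ?j := insert d (M (2 * ?j))))" using g(1) by simp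
      show "triple d (g (2 * ?j)) a b" using t by (simp add: y_def)
    qed (use g(2) in \<open>auto simp: M_def\<close>)
    moreover have "2 * ?j + 1 = ?a" "2 * ?j + 2 = ?b" "Suc ?j = n + 2" by simp_all
    ultimately have pc0: "partial_cover (path_graph (n + 2)) (g(?a := a, ?b := b)) (M(?a := ?A, ?b := ?B))"
      by (simp only:)
    let ?M0 = "M(?a := ?A, ?b := ?B)"
    define K1 where "K1 = attach 0 i (path_graph (n + 2))"
    define K2 where "K2 = attach 1 j K1"
    define K3 where "K3 = attach ?a l K2"
    have g01: "g 0 = u" "g 1 = v" using g(3)[of 0] g(3)[of 1] by (auto simp: f_def)
    have Vm: "0 \<in> verts (path_graph (n + 2))" "1 \<in> verts (path_graph (n + 2))"
      "?a \<in> verts (path_graph (n + 2))" "?b \<in> verts (path_graph (n + 2))" by (auto simp: V)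
    obtain f1 where f1: "partial_cover K1 f1 (?M0(0 := ?M0 0 - ?S))"
      and e1: "\<And>q. q \<in> verts (path_graph (n + 2)) \<Longrightarrow> f1 q = (g(?a := a, ?b := b)) q"
      and v1: "\<And>q. q \<in> verts (path_graph (n + 2)) \<Longrightarrow> q \<in> verts K1"
      unfolding K1_def
      by (rule obtain_attach[OF pc0 Vm(1), of ?S i]) (use p g01 in \<open>auto simp: M_def\<close>)
    let ?M1 = "?M0(0 := ?M0 0 - ?S)"
    obtain f2 where f2: "partial_cover K2 f2 (?M1(1 := ?M1 1 - ?T))"
      and e2: "\<And>q. q \<in> verts K1 \<Longrightarrow> f2 q = f1 q"
      and v2: "\<And>q. q \<in> verts K1 \<Longrightarrow> q \<in> verts K2"
      unfolding K2_def
      by (rule obtain_attach[OF f1 v1[OF Vm(2)], of ?T j]) (use p g01 e1[OF Vm(2)] in \<open>auto simp: M_def\<close>)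
    let ?M2 = "?M1(1 := ?M1 1 - ?T)"
    have a2: "f2 ?a = a" using e2[OF v1[OF Vm(3)]] e1[OF Vm(3)] by simp
    obtain f3 where f3: "partial_cover K3 f3 (?M2(?a := ?M2 ?a - ?A))"
      and e3: "\<And>q. q \<in> verts K2 \<Longrightarrow> f3 q = f2 q"
      and v3: "\<And>q. q \<in> verts K2 \<Longrightarrow> q \<in> verts K3"
      unfolding K3_def
      by (rule obtain_attach[OF f2 v2[OF v1[OF Vm(3)]], of ?A l]) (use q a2 in \<open>auto simp: M_def\<close>)
    let ?M3 = "?M2(?a := ?M2 ?a - ?A)"
    have b3: "f3 ?b = b" using e3[OF v2[OF v1[OF Vm(4)]]] e2[OF v1[OF Vm(4)]] e1[OF Vm(4)] by simp
    obtain f4 where f4: "partial_cover (attach ?b m K3) f4 (?M3(?b := ?M3 ?b - ?B))"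
      by (rule obtain_attach[OF f3 v3[OF v2[OF v1[OF Vm(4)]]], of ?B m]) (use q b3 in \<open>auto simp: M_def\<close>)
    have "hypergraph_iso H (attach ?b m K3)"
      by (rule partial_cover_done[OF f4]) (auto simp: M_def)
    then show "hypergraph_iso H (G_graph i j n l m)"
      by (simp add: G_graph_def K1_def K2_def K3_def)
  qed
qed


section \<open>Classification\<close>

text \<open>For degree 3 the two smaller weights are at most \<open>3 / 8\<close>, hence among
  \<open>1/4\<close>, \<open>1/3\<close>, \<open>3/8\<close>, and determine the third. Of the
  possible triples only \<open>1/4, 1/4, 1/2\<close> contains a weight that no pendant path has; it
  leads to the infinite families.\<close>

lemma high_degree_case:
  assumes v: "v \<in> verts H" and card: "card (inc H v) > 2"
  shows "(\<exists>n\<ge>5. hypergraph_iso H (D_tilde n)) \<or> (\<exists>n\<ge>6. hypergraph_iso H (BD_tilde n)) \<or>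
    (\<exists>K\<in>{S4_graph, E6_tilde, E7_tilde, E8_tilde}. hypergraph_iso H K)"
proof -
  have W: "W v (inc H v) = 1" using B_sum[OF v] by (simp add: W_def)
  have "card (inc H v) \<le> 4" using W_ge_card[of "inc H v" v] W by simp
  with card consider "card (inc H v) = 4" | "card (inc H v) = 3" by linarith
  then show ?thesis
  proof cases
    case 1
    have "B v e = 1 / 4" if e: "e \<in> inc H v" for e
    proof -
      have "card (inc H v - {e}) = 3" using 1 e by simp
      then have "1 - B v e \<ge> 3 / 4"
        using W_ge_card[of "inc H v - {e}" v] W_complement[OF e] by simp
      then show ?thesis using B_ge[OF e] by simp
    qed
    then have p: "pendant 1 v {e}" if "e \<in> inc H v" for e using pendant_1 that by blast
    obtain e1 T where e1: "inc H v = insert e1 T" "e1 \<notin> T" "card T = 3"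
      using 1 card_eq_SucD[of "inc H v" 3] by auto
    obtain e2 e3 e4 where T: "T = {e2, e3, e4}" "e2 \<noteq> e3" "e2 \<noteq> e4" "e3 \<noteq> e4"
      using e1(3) by (auto simp: card_3_iff)
    have i: "inc H v = {e1, e2, e3, e4}" "distinct [e1, e2, e3, e4]" using e1 T by auto
    have "hypergraph_iso H S4_graph"
      by (rule S4_iso[OF v i]; rule p) (simp_all add: i(1))
    then show ?thesis by blast
  next
    case 2
    define P where "P x y z \<longleftrightarrow> inc H v = {x, y, z} \<and> x \<noteq> y \<and> x \<noteq> z \<and> y \<noteq> z" for x y z
    obtain a b c where abc: "P a b c" using 2 unfolding P_def card_3_iff by blast
    obtain x y z where xyz: "P x y z" "B v x \<le> B v y" "B v y \<le> B v z"
    proof (rule obtain_sorted3[where P = P and g = "B v", OF abc])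
      show "P q p r" "P p r q" if "P p q r" for p q r
        using that unfolding P_def by (auto simp: insert_commute)
    qed
    have i: "inc H v = {x, y, z}" "x \<noteq> y" "x \<noteq> z" "y \<noteq> z" using xyz(1) by (auto simp: P_def)
    have sum: "B v x + B v y + B v z = 1" using W i by (simp add: W_def)
    have ge: "B v x \<ge> 1 / 4" "B v y \<ge> 1 / 4" "B v z \<ge> 1 / 4" using B_ge i by auto
    have pend: "pendant k v {e}" if "e \<in> inc H v" "B v e = path_weight k" "k \<le> 7" for e k
      using pendant_if_short[of "{e}" v k] that by simp
    have val: "B v e = 1 / 4 \<or> B v e = 1 / 3 \<or> B v e = 3 / 8"
      if e: "e \<in> inc H v" and l: "B v e < 2 / 5" for e
    proof -
      have "path_weight 4 = 2 / 5" by (simp add: path_weight_def)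
      then obtain k where k: "k < 4" "B v e = path_weight k"
        using short_pendant[of "{e}" v 4] e l by auto
      then have "k = 0 \<or> k = 1 \<or> k = 2 \<or> k = 3" by linarith
      then show ?thesis using k(2) B_ge[OF e] by (auto simp: path_weight_def)
    qed
    have E: "hypergraph_iso H (E_graph k1 k2 k3)"
      if "B v x = path_weight k1" "B v y = path_weight k2" "B v z = path_weight k3"
        "k1 \<le> 7" "k2 \<le> 7" "k3 \<le> 7" for k1 k2 k3
      by (rule E_iso[OF v i]) (use that i in \<open>auto intro!: pend\<close>)
    have x: "B v x = 1 / 4 \<or> B v x = 1 / 3"
      using val[of x] i sum xyz by auto
    show ?thesis
    proof (cases "B v x = 1 / 3")
      case True
      then have "hypergraph_iso H (E_graph 2 2 2)"
        using sum xyz by (intro E) (auto simp: path_weight_def)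
      then show ?thesis by (simp add: E6_tilde_def)
    next
      case False
      then have x: "B v x = 1 / 4" using x by blast
      then have "B v y = 1 / 4 \<or> B v y = 1 / 3 \<or> B v y = 3 / 8"
        using val[of y] i sum xyz by auto
      then consider "B v y = 1 / 4" "B v z = 1 / 2" | "B v y = 1 / 3" "B v z = 5 / 12" | "B v y = 3 / 8" "B v z = 3 / 8"
        using x sum by linarith
      then show ?thesis
      proof cases
        case 1
        then show ?thesis using D_case[OF i x] by blast
      next
        case 2
        then have "hypergraph_iso H (E_graph 1 2 5)"
          using x by (intro E) (auto simp: path_weight_def)
        then show ?thesis by (simp add: E8_tilde_def)
      next
        case 3
        then have "hypergraph_iso H (E_graph 1 3 3)"
          using x by (intro E) (auto simp: path_weight_def)
        then show ?thesis by (simp add: E7_tilde_def)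
      qed
    qed
  qed
qed

text \<open>Beyond \<open>e\<close> the weight starts at \<open>5 / 9\<close>, off the fixed point,
  so its value at the far edge reveals \<open>n\<close>. There two weights of at most
  \<open>3 / 4\<close> need a product in \<open>[9/20, 1/2)\<close>, where
  \<open>9/20 = (1/4) / (5/9)\<close>. Only \<open>3/4 * 3/5\<close> and \<open>3/4 * 5/8\<close>
  qualify, and they belong to \<open>n = 0\<close> and \<open>n = 6\<close>.\<close>

lemma two_pendants_case:
  assumes deg: "\<And>v. card (inc H v) \<le> 2" and two: "two_pendants e"
  shows "hypergraph_iso H (G_graph 1 1 0 1 4) \<or> hypergraph_iso H (G_graph 1 1 6 1 3)"
proof -
  obtain x u v where t0: "triple e x u v" and B: "B u e = 3 / 4" "B v e = 3 / 4"
    using two by (auto simp: two_pendants_def)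
  have t: "triple e u v x" using triple_rot[OF t0] .
  note i = triple_inc[OF t]
  have nl: "\<not> leaf u e" "\<not> leaf v e" using B B_eq_1[OF i(1)] B_eq_1[OF i(2)] by auto
  have "9 / 16 * B x e = 1 / 4" using triple_prod[OF t] B by simp
  then have Bx: "B x e = 4 / 9" by simp
  then have "\<not> leaf x e" using B_eq_1[OF i(3)] by auto
  then obtain e0 where e0: "inc H x = {e, e0}" "e0 \<noteq> e" by (rule two_edges[OF i(3) _ deg])
  have "inc H x - {e} = {e0}" using e0 by auto
  then have Be0: "B x e0 = 5 / 9" using W_complement[OF i(3)] Bx by simp
  \<comment> \<open>the iterates of \<open>t \<mapsto> 1 - 1 / (4 t)\<close> on \<open>5 / 9\<close>, decreasing to the fixed point \<open>1 / 2\<close>\<close>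
  define w :: "nat \<Rightarrow> real" where "w n = 1/2 + 1 / (2 * (9 + n))" for n
  have wS: "w (Suc n) = 1 - 1 / (4 * w n)" for n
  proof -
    have "w n = (10 + real n) / (2 * (9 + real n))" by (simp add: w_def add_divide_distrib[symmetric] field_simps)
    moreover have "w (Suc n) = (11 + real n) / (2 * (10 + real n))" by (simp add: w_def field_simps)
    ultimately show ?thesis by (simp only:) (simp add: field_simps)
  qed
  obtain n y d where d: "d \<in> inc H y" "B y d = w n"
    and nl': "\<And>a b. triple d y a b \<Longrightarrow> \<not> leaf a d \<and> \<not> leaf b d"
    and iso: "\<And>a b l m. triple d y a b \<Longrightarrow> pendant l a (inc H a - {d}) \<Longrightarrow> pendant m b (inc H b - {d}) \<Longrightarrow>
       hypergraph_iso H (G_graph 1 1 n l m)"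
  proof (rule G_walk[OF deg t nl e0, of 1 1 w])
    show "pendant 1 u (inc H u - {e})" "pendant 1 v (inc H v - {e})"
      using i B by (auto intro!: pendant_complement simp: path_weight_def)
    show "B x e0 = w 0" by (simp add: Be0 w_def)
    show "w n \<noteq> 1 / 4" for n
    proof -
      have "w n > 1 / 2" by (simp add: w_def)
      then show ?thesis by simp
    qed
  qed (use wS in auto)
  obtain a' b' where t': "triple d y a' b'"
    by (rule obtain_triple[of d y]) (use d in \<open>auto simp: inc_iff\<close>)
  obtain a b where ab: "triple d y a b" and le: "B b d \<le> B a d"
    using t' triple_swap[OF t'] by (metis linear)
  note j = triple_inc[OF ab]
  have ub: "B a d \<le> 3/4" "B b d \<le> 3/4" "B a d > 0" "B b d > 0"
    using nl'[OF ab] nonleaf_le j B_pos' by auto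
  have w0: "w n > 1/2" "w n \<le> 5/9" by (simp_all add: w_def field_simps)
  have p: "w n * (B a d * B b d) = 1 / 4" using triple_prod[OF ab] d by (simp add: mult.assoc)
  have lo: "B a d * B b d \<ge> 9/20"
  proof (rule ccontr)
    assume "\<not> ?thesis"
    then have "w n * (B a d * B b d) < 5/9 * (9/20)" using w0 ub by (intro mult_le_less_imp_less) auto
    then show False using p by simp
  qed
  have hi: "B a d * B b d < 1/2"
  proof (rule ccontr)
    assume "\<not> ?thesis"
    then have "w n * (B a d * B b d) > 1/2 * (1/2)" using w0 by (intro mult_less_le_imp_less) auto
    then show False using p by simp
  qed
  have "3/4 * B b d \<ge> B a d * B b d" using ub by (intro mult_right_mono) auto
  then have "B b d \<ge> 3/5" using lo by auto
  then have mem: "B a d \<in> {3/4, 2/3, 5/8, 3/5}" "B b d \<in> {3/4, 2/3, 5/8, 3/5}"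
    using B_cases[OF j(2)] B_cases[OF j(3)] ub le by auto
  have "x = 3/4 \<and> (y = 5/8 \<or> y = 3/5)"
    if "x \<in> {3/4, 2/3, 5/8, 3/5}" "y \<in> {3/4, 2/3, 5/8, 3/5}" "y \<le> x" "x * y \<ge> 9/20" "x * y < 1/2" for x y :: real
    using that by (elim insertE emptyE; hypsubst; simp)
  from this[OF mem le lo hi] have Ba: "B a d = 3/4" and Bb: "B b d = 5/8 \<or> B b d = 3/5" by auto
  have pa: "pendant 1 a (inc H a - {d})"
    using j Ba by (auto intro!: pendant_complement simp: path_weight_def)
  show ?thesis
    using Bb
  proof
    assume b: "B b d = 5/8"
    have "w n = 8/15" using p Ba b by simp
    then have "n = 6" by (simp add: w_def field_simps)
    moreover have "pendant 3 b (inc H b - {d})"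
      using j b by (auto intro!: pendant_complement simp: path_weight_def)
    ultimately show ?thesis using iso[OF ab pa] by blast
  next
    assume b: "B b d = 3/5"
    have "w n = 5/9" using p Ba b by simp
    then have "n = 0" by (simp add: w_def field_simps)
    moreover have "pendant 4 b (inc H b - {d})"
      using j b by (auto intro!: pendant_complement simp: path_weight_def)
    ultimately show ?thesis using iso[OF ab pa] by blast
  qed
qed

text \<open>The third weight is the fixed point \<open>1 / 2\<close>, so the walk may have any
  length, and \<open>half_end\<close> forces a copy of the pattern at \<open>e\<close> at its other
  end.\<close>

lemma B_case:
  assumes deg: "\<And>v. card (inc H v) \<le> 2"
    and t: "triple e u v x" and B: "B u e = 3 / 4" "B v e = 2 / 3" "B x e = 1 / 2"
  shows "\<exists>n\<ge>8. hypergraph_iso H (B_tilde n)"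
proof -
  note i = triple_inc[OF t]
  have nl: "\<not> leaf u e" "\<not> leaf v e" "\<not> leaf x e"
    using B B_eq_1[OF i(1)] B_eq_1[OF i(2)] B_eq_1[OF i(3)] by auto
  obtain e0 where e0: "inc H x = {e, e0}" "e0 \<noteq> e" by (rule two_edges[OF i(3) nl(3) deg])
  have "inc H x - {e} = {e0}" using e0 by auto
  then have Be0: "B x e0 = 1 / 2" using W_complement[OF i(3)] B by simp
  obtain n y d where d: "d \<in> inc H y" "B y d = 1 / 2"
    and nl': "\<And>a b. triple d y a b \<Longrightarrow> \<not> leaf a d \<and> \<not> leaf b d"
    and iso: "\<And>a b l m. triple d y a b \<Longrightarrow> pendant l a (inc H a - {d}) \<Longrightarrow> pendant m b (inc H b - {d}) \<Longrightarrow>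
       hypergraph_iso H (G_graph 1 2 n l m)"
  proof (rule G_walk[OF deg t nl(1,2) e0, of 1 2 "\<lambda>_. 1 / 2"])
    show "pendant 1 u (inc H u - {e})" "pendant 2 v (inc H v - {e})"
      using i B by (auto intro!: pendant_complement simp: path_weight_def)
  qed (use Be0 in auto)
  obtain a b where ab: "triple d y a b" "pendant 1 a (inc H a - {d})" "pendant 2 b (inc H b - {d})"
    by (rule half_end[OF d nl'])
  have "hypergraph_iso H (B_tilde (n + 8))" using iso[OF ab] by (simp add: B_tilde_def)
  then show ?thesis by (meson le_add2)
qed

text \<open>The largest weight is \<open>3 / 4\<close> or \<open>2 / 3\<close>, the middle one comes
  from a short list, and the product fixes the third. Its complement is the weight of a pendant
  path, except for \<open>3/4, 2/3, 1/2\<close>, where an internal path starts and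
  \<open>B_case\<close> applies.\<close>

lemma branching_edge_case:
  assumes deg: "\<And>v. card (inc H v) \<le> 2" and no: "\<And>e. \<not> two_pendants e"
    and e: "e \<in> edges H" and nl: "\<And>v. v \<in> e \<Longrightarrow> \<not> leaf v e"
  shows "(\<exists>n\<ge>8. hypergraph_iso H (B_tilde n)) \<or>
    (\<exists>K\<in>{F_graph 2 3 4, F_graph 2 2 7, F_graph 1 5 6, F_graph 1 4 8, F_graph 1 3 14}. hypergraph_iso H K)"
proof -
  obtain a where "a \<in> e" using edge_card[OF e] by fastforce
  then obtain b c where abc: "triple e a b c" using obtain_triple[OF e] by metis
  \<comment> \<open>The minus signs sort the weights in decreasing order.\<close>
  obtain u v w where t: "triple e u v w" and le: "- B u e \<le> - B v e" "- B v e \<le> - B w e"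
  proof (rule obtain_sorted3[where P = "triple e" and g = "\<lambda>v. - B v e", OF abc])
    show "triple e q p r" "triple e p r q" if "triple e p q r" for p q r
      using that unfolding triple_def by (auto simp: insert_commute)
  qed
  note i = triple_inc[OF t]
  have uvw: "u \<in> e" "v \<in> e" "w \<in> e" using t by (auto simp: triple_def)
  have b: "B u e \<le> 3/4" "B v e \<le> 3/4" "B w e \<le> 3/4" "B u e > 0" "B v e > 0" "B w e > 0"
    using nl[OF uvw(1)] nl[OF uvw(2)] nl[OF uvw(3)] nonleaf_le i B_pos' by auto
  have p: "B u e * B v e * B w e = 1 / 4" by (rule triple_prod[OF t])
  have pend: "pendant k y (inc H y - {e})" if "e \<in> inc H y" "1 - B y e = path_weight k" for y k
    using pendant_if_no_two[OF no, of "inc H y - {e}" y k] W_complement[of e y] that by auto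
  have F: "hypergraph_iso H (F_graph i j k)"
    if "1 - B u e = path_weight i" "1 - B v e = path_weight j" "1 - B w e = path_weight k" for i j k
    by (rule F_iso[OF t]) (use i that in \<open>auto intro!: pend\<close>)
  have no': "\<not> (B u e = 3/4 \<and> B v e = 3/4)"
    using no[of e] triple_rot[OF triple_rot[OF t]] by (auto simp: two_pendants_def)
  \<comment> \<open>\<open>(5/8)^3 = 125/512\<close> is below \<open>1/4\<close>. The bounds for the
    middle weight arise likewise from \<open>(3/5)^2 < 3/8\<close> and
    \<open>(4/7)^2 < 1/3\<close>.\<close>
  have Bu: "B u e > 5/8"
  proof (rule ccontr)
    assume n: "\<not> B u e > 5/8"
    then have "B u e * B v e \<le> 5/8 * (5/8)" using b le by (intro mult_mono) auto
    then have "B u e * B v e * B w e \<le> 5/8 * (5/8) * (5/8)" using b le n by (intro mult_mono) auto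
    then show False using p by simp
  qed
  then have "B u e \<in> {3/4, 2/3}" using B_cases[OF i(1)] b by auto
  then consider "B u e = 2/3" | "B u e = 3/4" by blast
  then show ?thesis
  proof cases
    case 1
    have "2/3 * (B v e * B w e) = 1/4" using p unfolding 1 mult.assoc .
    then have q: "B v e * B w e = 3/8" by simp
    have "B v e > 3/5"
    proof (rule ccontr)
      assume "\<not> B v e > 3/5"
      then have "B v e * B w e \<le> 3/5 * (3/5)" using b le by (intro mult_mono) auto
      then show False using q by simp
    qed
    then have "B v e = 2/3 \<or> B v e = 5/8" using B_cases[OF i(2)] le 1 by auto
    then show ?thesis
    proof
      assume v: "B v e = 2/3"
      then have "B w e = 9/16" using q unfolding v by simp
      then have "hypergraph_iso H (F_graph 2 2 7)" using 1 v by (intro F) (simp_all add: path_weight_def)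
      then show ?thesis by blast
    next
      assume v: "B v e = 5/8"
      then have "B w e = 3/5" using q unfolding v by simp
      then have "hypergraph_iso H (F_graph 2 3 4)" using 1 v by (intro F) (simp_all add: path_weight_def)
      then show ?thesis by blast
    qed
  next
    case 2
    have "3/4 * (B v e * B w e) = 1/4" using p unfolding 2 mult.assoc .
    then have q: "B v e * B w e = 1/3" by simp
    have "B v e > 4/7"
    proof (rule ccontr)
      assume "\<not> B v e > 4/7"
      then have "B v e * B w e \<le> 4/7 * (4/7)" using b le by (intro mult_mono) auto
      then show False using q by simp
    qed
    then have "B v e \<in> {1, 3/4, 2/3, 5/8, 3/5, 7/12}" using B_cases[OF i(2)] by blast
    moreover have "B v e \<noteq> 1" "B v e \<noteq> 3/4" using b no' 2 by auto
    ultimately consider "B v e = 2/3" | "B v e = 5/8" | "B v e = 3/5" | "B v e = 7/12" by blast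
    then show ?thesis
    proof cases
      case v: 1
      then have "B w e = 1/2" using q unfolding v by simp
      then show ?thesis using B_case[OF deg t 2 v] by blast
    next
      case v: 2
      then have "B w e = 8/15" using q unfolding v by simp
      then have "hypergraph_iso H (F_graph 1 3 14)" using 2 v by (intro F) (simp_all add: path_weight_def)
      then show ?thesis by blast
    next
      case v: 3
      then have "B w e = 5/9" using q unfolding v by simp
      then have "hypergraph_iso H (F_graph 1 4 8)" using 2 v by (intro F) (simp_all add: path_weight_def)
      then show ?thesis by blast
    next
      case v: 4
      then have "B w e = 4/7" using q unfolding v by simp
      then have "hypergraph_iso H (F_graph 1 5 6)" using 2 v by (intro F) (simp_all add: path_weight_def)
      then show ?thesis by blast
    qed
  qed
qed

end

section \<open>Cycles\<close>

text \<open>The cycle argument treats length 2 uniformly: with indices mod 2 the two edges share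
  both joints.\<close>

lemma C_graph_2: "C_graph 2 = C2_graph"
proof -
  have "{..<2} = {0, 1::nat}" "{..<4} = {0, 1, 2, 3::nat}" by auto
  then show ?thesis by (simp add: C_graph_def C2_graph_def insert_commute eval_nat_numeral)
qed

context quarter_weighting
begin

text \<open>Take the least weight \<open>t > 1 / 2\<close> at a nonleaf. Crossing the edge gives
  another such weight \<open>1 - 1 / (4 * t)\<close>, still above \<open>1 / 2\<close> but smaller
  than \<open>t\<close>, because \<open>(2 * t - 1)^2 > 0\<close>.\<close>

lemma no_heavy_nonleaf:
  assumes deg: "\<And>v. card (inc H v) \<le> 2"
    and leafy: "\<And>e. e \<in> edges H \<Longrightarrow> \<exists>v\<in>e. leaf v e"
    and e: "e \<in> inc H v" "\<not> leaf v e"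
  shows "B v e \<le> 1 / 2"
proof (rule ccontr)
  assume "\<not> B v e \<le> 1 / 2"
  define F where "F = {(v, e). e \<in> inc H v \<and> \<not> leaf v e \<and> B v e > 1 / 2}"
  have "F \<subseteq> verts H \<times> edges H" using inc_vert by (auto simp: F_def inc_iff)
  then have "finite F" using finite_verts finite_edges by (meson finite_SigmaI finite_subset)
  moreover have "(v, e) \<in> F" using e \<open>\<not> B v e \<le> 1 / 2\<close> by (simp add: F_def not_le)
  then have "F \<noteq> {}" by blast
  ultimately have "\<exists>p. is_arg_min (\<lambda>(v, e). B v e) (\<lambda>p. p \<in> F) p"
    using ex_is_arg_min_if_finite by blast
  then obtain p where p: "p \<in> F" "\<And>q. q \<in> F \<Longrightarrow> (\<lambda>(v, e). B v e) p \<le> (\<lambda>(v, e). B v e) q"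
    by (auto simp: is_arg_min_linorder)
  obtain v e where ve: "p = (v, e)" by (cases p)
  have e: "e \<in> inc H v" "\<not> leaf v e" "B v e > 1 / 2" using p(1) by (auto simp: ve F_def)
  obtain a where a: "a \<in> e" "leaf a e" using leafy e(1) by (auto simp: inc_iff)
  obtain a' b' where "triple e v a' b'"
    by (rule obtain_triple[of e v]) (use e(1) in \<open>auto simp: inc_iff\<close>)
  moreover have "a \<noteq> v" using a e by auto
  ultimately obtain b where t: "triple e v a b"
    using a(1) triple_swap[of e v a' b'] by (auto simp: triple_def)
  have prod: "B v e * B b e = 1 / 4" by (rule leaf_edge_weight[OF t a(2)])
  note i = triple_inc[OF t]
  have "B b e = 1 / (4 * B v e)" using prod e(3) by (simp add: field_simps)
  moreover have "1 / (4 * B v e) < 1 / 2" using e(3) by (simp add: field_simps)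
  ultimately have Bb: "B b e = 1 / (4 * B v e)" "B b e < 1 / 2" by simp_all
  then have "\<not> leaf b e" using B_eq_1[OF i(3)] by auto
  then obtain d where d: "inc H b = {e, d}" "d \<noteq> e" by (rule two_edges[OF i(3) _ deg])
  have "inc H b - {e} = {d}" using d by auto
  then have Bd: "B b d = 1 - B b e" using W_complement[OF i(3)] by simp
  then have "(b, d) \<in> F" using d Bb by (auto simp: F_def)
  then have "B v e \<le> B b d" using p(2)[of "(b, d)"] ve by simp
  moreover have "1 - 1 / (4 * B v e) < B v e"
  proof -
    have "0 < (2 * B v e - 1)\<^sup>2" using e(3) by simp
    then have "(1 - B v e) * (4 * B v e) < 1" by (simp add: power2_eq_square algebra_simps)
    then have "1 - B v e < 1 / (4 * B v e)" using e(3) by (simp add: less_divide_eq)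
    then show ?thesis by simp
  qed
  ultimately show False using Bd Bb by simp
qed

text \<open>A cycle with \<open>n\<close> edges has \<open>2 * n\<close> vertices and so violates
  the count behind \<open>partial_cover\<close>. The isomorphism is instead read off a walk up to
  its first return.\<close>

lemma cycle_case:
  assumes ne: "verts H \<noteq> {}" and deg: "\<And>v. card (inc H v) \<le> 2"
    and leafy: "\<And>e. e \<in> edges H \<Longrightarrow> \<exists>v\<in>e. leaf v e"
  shows "\<exists>n\<ge>2. hypergraph_iso H (C_graph n)"
proof -
  note light = no_heavy_nonleaf[OF deg leafy]
  \<comment> \<open>A second leaf would press the third weight down to \<open>1 / 4\<close> and
    leave the too heavy \<open>3 / 4\<close> to the next edge.\<close>
  have nonleaf: "\<not> leaf v e" if t: "triple e v a b" and l: "leaf a e" for v e a b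
  proof
    assume lv: "leaf v e"
    note i = triple_inc[OF t]
    have Bb: "B b e = 1 / 4"
      using triple_prod[OF t] B_eq_1[OF i(1)] B_eq_1[OF i(2)] lv l by simp
    then have "\<not> leaf b e" using B_eq_1[OF i(3)] by auto
    then obtain d where d: "inc H b = {e, d}" "d \<noteq> e" by (rule two_edges[OF i(3) _ deg])
    have "inc H b - {e} = {d}" using d by auto
    then have "B b d = 3 / 4" using W_complement[OF i(3)] Bb by simp
    moreover have "d \<in> inc H b" "\<not> leaf b d" using d by auto
    ultimately show False using light[of d b] by simp
  qed
  have step: "\<exists>y. walk_step x y \<and> snd y \<in> inc H (fst y) \<and> \<not> leaf (fst y) (snd y)"
    if x: "snd x \<in> inc H (fst x)" "\<not> leaf (fst x) (snd x)" for x
  proof -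
    obtain v e where ve: "x = (v, e)" by (cases x)
    obtain a where a: "a \<in> e" "leaf a e" using leafy[of e] x(1) by (auto simp: inc_iff ve)
    obtain a' b' where "triple e v a' b'"
      by (rule obtain_triple[of e v]) (use x(1) in \<open>auto simp: inc_iff ve\<close>)
    moreover have "a \<noteq> v" using a x ve by auto
    ultimately obtain b where t: "triple e v a b"
      using a(1) triple_swap[of e v a' b'] by (auto simp: triple_def)
    have "triple e b a v" using triple_swap[OF triple_rot[OF triple_rot[OF t]]] .
    then have "\<not> leaf b e" by (rule nonleaf[OF _ a(2)])
    then obtain d where d: "inc H b = {e, d}" "d \<noteq> e" by (rule two_edges[OF triple_inc(3)[OF t] _ deg])
    then have "walk_step (v, e) (b, d)" using t a(2) by (auto simp: walk_step_def)
    then show ?thesis using d ve by (intro exI[of _ "(b, d)"]) auto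
  qed
  have start: "\<exists>x. snd x \<in> inc H (fst x) \<and> \<not> leaf (fst x) (snd x)"
  proof -
    obtain u where u: "u \<in> verts H" using ne by blast
    then have "inc H u \<noteq> {}" using B_sum[OF u] by auto
    then obtain e where e: "e \<in> edges H" by (auto simp: inc_iff)
    then obtain a where a: "a \<in> e" "leaf a e" using leafy by blast
    obtain v b where "triple e a v b" by (rule obtain_triple[OF e a(1)])
    then have t: "triple e v a b" using triple_rot triple_swap by blast
    then show ?thesis using nonleaf[OF t a(2)] triple_inc[OF t] by (intro exI[of _ "(v, e)"]) auto
  qed
  obtain s where s: "\<And>n. snd (s n) \<in> inc H (fst (s n)) \<and> \<not> leaf (fst (s n)) (snd (s n))"
    and walk: "\<And>n. walk_step (s n) (s (Suc n))"
    using dependent_nat_choice[of "\<lambda>_ x. snd x \<in> inc H (fst x) \<and> \<not> leaf (fst x) (snd x)" "\<lambda>_. walk_step"]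
      start step by (metis (no_types, lifting))
  define V where "V n = fst (s n)" for n
  define E where "E n = snd (s n)" for n
  have "\<exists>a. triple (E n) (V n) a (V (Suc n)) \<and> leaf a (E n)" for n
    using walk[of n] by (auto simp: walk_step_def V_def E_def split: prod.splits)
  then obtain L where t: "\<And>n. triple (E n) (V n) (L n) (V (Suc n))" and L: "\<And>n. leaf (L n) (E n)" by metis
  have inc: "inc H (V (Suc n)) = {E n, E (Suc n)}" and EE: "E (Suc n) \<noteq> E n" for n
    using walk[of n] by (auto simp: walk_step_def V_def E_def split: prod.splits)
  have nl: "\<not> leaf (V n) (E n)" for n using s by (simp add: V_def E_def)
  have Eset: "E n = {V n, L n, V (Suc n)}" "V n \<noteq> V (Suc n)" "E n \<in> edges H" for n
    using t[of n] by (auto simp: triple_def)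
  have VE: "E n \<in> inc H (V n)" for n by (rule triple_inc(1)[OF t])
  have LV: "L i \<noteq> V k" for i k
  proof
    assume "L i = V k"
    then have i: "inc H (V k) = {E i}" using L[of i] by simp
    then have "E k = E i" using VE[of k] by simp
    then show False using nl[of k] i by simp
  qed
  have V_in_E: "V k = V n \<or> V k = V (Suc n)" if "V k \<in> E n" for k n
    using that Eset(1)[of n] LV[of n k] by auto
  have "range V \<subseteq> verts H" using VE inc_vert by blast
  then have "\<not> inj V" using finite_verts by (meson finite_imageD finite_subset infinite_UNIV_nat)
  then have "\<exists>j. V j \<in> V ` {..<j}"
    unfolding inj_def by (metis image_eqI lessThan_iff linorder_neqE_nat)
  \<comment> \<open>The least repetition makes \<open>V\<close> injective below \<open>j\<close>; it
    turns out to be the length of the cycle.\<close>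
  define j where "j = (LEAST j. V j \<in> V ` {..<j})"
  have j: "V j \<in> V ` {..<j}" unfolding j_def using \<open>\<exists>j. V j \<in> V ` {..<j}\<close> by (rule LeastI_ex)
  have dist: "i = k" if "V i = V k" "i < j" "k < j" for i k
  proof -
    have "V l \<notin> V ` {..<l}" if "l < j" for l using that not_less_Least unfolding j_def by blast
    then show ?thesis using that by (metis image_eqI lessThan_iff linorder_neqE_nat)
  qed
  obtain i where i: "i < j" "V j = V i" using j by auto
  obtain m where m: "j = Suc m" using i by (cases j) auto
  \<comment> \<open>A later vertex of the walk already has both of its edges on it. Returning there
    would use one of them and make \<open>V m\<close> coincide with a neighbouring vertex of the
    walk, against the choice of \<open>j\<close> or the rule that consecutive vertices and edges
    differ.\<close>
  have "i = 0"
  proof (rule ccontr)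
    assume "i \<noteq> 0"
    then obtain l where l: "i = Suc l" by (cases i) auto
    have "E m \<in> inc H (V (Suc m))" using inc by simp
    then have "E m \<in> {E l, E (Suc l)}" using inc[of l] i m l by simp
    then have "V m \<in> E l \<or> V m \<in> E (Suc l)" using Eset(1)[of m] by auto
    then have "V m = V l \<or> V m = V (Suc l) \<or> V m = V (Suc (Suc l))" using V_in_E by blast
    moreover have "V m \<noteq> V l" using dist[of m l] i m l by auto
    moreover have "V m \<noteq> V (Suc l)" using Eset(2)[of m] i m l by auto
    ultimately have e: "V m = V (Suc (Suc l))" by blast
    have "m \<noteq> Suc l" using e \<open>V m \<noteq> V (Suc l)\<close> by auto
    then have "m = Suc (Suc l)" using dist[of m "Suc (Suc l)"] e i m l by simp
    then have "E m \<noteq> E (Suc l)" using EE[of "Suc l"] by simp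
    then have "E m = E l" using \<open>E m \<in> {E l, E (Suc l)}\<close> by simp
    then have "V m \<in> E l" using Eset(1)[of m] by auto
    then show False using V_in_E[of m l] \<open>V m \<noteq> V l\<close> \<open>V m \<noteq> V (Suc l)\<close> by blast
  qed
  then have V0: "V (Suc m) = V 0" using i m by simp
  have m0: "m \<noteq> 0" using V0 Eset(2)[of 0] by (intro notI) simp
  \<comment> \<open>The walk does not close by going back along its first edge, so
    \<open>E m\<close> and \<open>E 0\<close> exhaust the degree 2 of \<open>V 0\<close>.\<close>
  have Em: "E m \<noteq> E 0"
  proof
    assume e: "E m = E 0"
    then have "V m \<in> E 0" using Eset(1)[of m] by auto
    then have "V m = V 0 \<or> V m = V 1" using V_in_E[of m 0] by simp
    then have "m = 1" using dist[of m 0] dist[of m 1] m m0 by auto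
    then show False using e EE[of 0] by simp
  qed
  have inc0: "inc H (V 0) = {E m, E 0}"
  proof -
    have "{E m, E 0} \<subseteq> inc H (V 0)" using inc[of m] VE[of 0] by (simp add: V0)
    moreover have "card {E m, E 0} = 2" using Em by simp
    ultimately show ?thesis using deg[of "V 0"] finite_inc card_seteq by metis
  qed
  \<comment> \<open>The numbering of \<open>C_graph\<close>: joints below \<open>j\<close>, then the
    leaf of each edge.\<close>
  define g where "g q = (if q < j then V q else L (q - j))" for q
  have gE: "g ` {q, Suc q mod j, j + q} = E q" if "q < j" for q
  proof (cases "q = m")
    case True
    then show ?thesis using Eset(1)[of m] V0 m by (auto simp: g_def)
  next
    case False
    then show ?thesis using Eset(1)[of q] that m by (auto simp: g_def)
  qed
  have incV: "inc H (V q) \<subseteq> E ` {..<j}" if "q < j" for q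
  proof (cases q)
    case 0
    then show ?thesis using inc0 m by auto
  next
    case (Suc l)
    then show ?thesis using inc[of l] that by auto
  qed
  have sub: "E q \<subseteq> g ` {..<2 * j}" if "q < j" for q
  proof -
    have "Suc q mod j < 2 * j" using mod_less_divisor[of j "Suc q"] m by linarith
    then have "{q, Suc q mod j, j + q} \<subseteq> {..<2 * j}" using that by auto
    then show ?thesis using gE[OF that] by (metis image_mono)
  qed
  have gv: "g ` {..<2 * j} \<subseteq> verts H"
  proof
    fix v assume "v \<in> g ` {..<2 * j}"
    then obtain q where q: "q < 2 * j" "v = g q" by auto
    then have "v \<in> E (if q < j then q else q - j)" using Eset(1) by (auto simp: g_def)
    then show "v \<in> verts H" using Eset(3) edge_sub by blast
  qed
  have incg: "inc H v \<subseteq> E ` {..<j}" if "v \<in> g ` {..<2 * j}" for v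
    using that incV L by (auto simp: g_def)
  have surj: "g ` {..<2 * j} = verts H"
  proof (rule connected_hypergraph_closed[OF connected gv])
    show "g ` {..<2 * j} \<noteq> {}" using m by auto
    fix e assume e: "e \<in> edges H" "e \<inter> g ` {..<2 * j} \<noteq> {}"
    then obtain v where v: "v \<in> e" "v \<in> g ` {..<2 * j}" by blast
    then have "e \<in> inc H v" using e(1) by (simp add: inc_iff)
    then have "e \<in> E ` {..<j}" using incg[OF v(2)] by blast
    then show "e \<inter> verts H \<subseteq> g ` {..<2 * j}" using sub by auto
  qed
  have edges: "edges H = E ` {..<j}"
  proof
    show "edges H \<subseteq> E ` {..<j}"
    proof
      fix e assume e: "e \<in> edges H"
      obtain v where v: "v \<in> e" using edge_card[OF e] by fastforce
      then have gv: "v \<in> g ` {..<2 * j}" using surj edge_sub[OF e] by auto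
      have "e \<in> inc H v" using v e by (simp add: inc_iff)
      then show "e \<in> E ` {..<j}" using incg[OF gv] by blast
    qed
  qed (use Eset(3) in auto)
  have Einj: "i = k" if "E i = E k" "i \<le> k" "k < j" for i k
  proof (rule ccontr)
    assume "i \<noteq> k"
    have "V k \<in> E i" using that(1) Eset(1)[of k] by auto
    then have "V k = V i \<or> V k = V (Suc i)" by (rule V_in_E)
    then have "k = Suc i" using dist[of k i] dist[of k "Suc i"] that \<open>i \<noteq> k\<close> by auto
    then show False using EE[of i] that(1) by simp
  qed
  have Linj: "i = k" if "L i = L k" "i < j" "k < j" for i k
  proof -
    have "E i = E k" using L[of i] L[of k] that(1) by simp
    then show ?thesis using Einj[of i k] Einj[of k i] that by (metis nat_le_linear)
  qed
  have "inj_on g {..<2 * j}"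
  proof (rule inj_onI)
    fix p q assume pq: "p \<in> {..<2 * j}" "q \<in> {..<2 * j}" "g p = g q"
    consider "p < j" "q < j" | "p \<ge> j" "q \<ge> j" | "p < j" "q \<ge> j" | "p \<ge> j" "q < j" by linarith
    then show "p = q"
    proof cases
      case 1 then show ?thesis using pq dist by (simp add: g_def)
    next
      case 2
      have "p - j < j" "q - j < j" using pq(1,2) m by auto
      moreover have "L (p - j) = L (q - j)" using 2 pq(3) by (simp add: g_def)
      ultimately have "p - j = q - j" using Linj by blast
      then show ?thesis using 2 by simp
    next
      case 3 then show ?thesis using pq(3) LV[of "q - j" p] by (simp add: g_def)
    next
      case 4 then show ?thesis using pq(3) LV[of "p - j" q] by (simp add: g_def)
    qed
  qed
  then have "bij_betw g (verts (C_graph j)) (verts H)"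
    using surj by (simp add: bij_betw_def C_graph_def)
  moreover have "edges H = (`) g ` edges (C_graph j)"
    unfolding edges C_graph_def snd_conv image_image by (rule image_cong) (use gE in auto)
  moreover have "d \<subseteq> verts (C_graph j)" if "d \<in> edges (C_graph j)" for d
  proof -
    have "Suc q mod j < 2 * j" for q using mod_less_divisor[of j "Suc q"] m by linarith
    then show ?thesis using that by (auto simp: C_graph_def)
  qed
  ultimately have "hypergraph_iso H (C_graph j)" by (rule hypergraph_isoI)
  moreover have "j \<ge> 2" using m m0 by simp
  ultimately show ?thesis by blast
qed

end

theorem theorem1:
  fixes H :: "'a hypergraph"
  assumes "uniform_hypergraph 3 H"
    and "connected_hypergraph H"
    and "spectral_radius 3 H = 2 * root 3 4"
  shows "(\<exists>n\<ge>3. hypergraph_iso H (C_graph n)) \<or>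
         (\<exists>n\<ge>5. hypergraph_iso H (D_tilde n)) \<or>
         (\<exists>n\<ge>8. hypergraph_iso H (B_tilde n)) \<or>
         (\<exists>n\<ge>6. hypergraph_iso H (BD_tilde n)) \<or>
         (\<exists>K\<in>{C2_graph, S4_graph, E6_tilde, E7_tilde, E8_tilde,
               F_graph 2 3 4, F_graph 2 2 7, F_graph 1 5 6, F_graph 1 4 8, F_graph 1 3 14,
               G_graph 1 1 0 1 4, G_graph 1 1 6 1 3}.
            hypergraph_iso H K)"
proof -
  obtain B where "\<And>v e. e \<in> edges H \<Longrightarrow> v \<in> e \<Longrightarrow> B v e > 0"
    "\<And>v. v \<in> verts H \<Longrightarrow> (\<Sum>e\<in>inc H v. B v e) = (1::real)"
    "\<And>e. e \<in> edges H \<Longrightarrow> (\<Prod>v\<in>e. B v e) = 1 / 4"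
    using quarter_weighting_exists[OF assms] by metis
  then interpret quarter_weighting H B
    by unfold_locales (use assms in auto)
  have ne: "verts H \<noteq> {}" using assms(3) by (auto simp: spectral_radius_def)
  \<comment> \<open>\<open>two_pendants\<close> is split off before general leafless edges, since in
    its absence every weight \<open>path_weight k\<close> is known to come from a pendant
    path.\<close>
  consider (high) v where "v \<in> verts H" "card (inc H v) > 2"
    | (two) e where "\<And>v. card (inc H v) \<le> 2" "two_pendants e"
    | (branch) e where "\<And>v. card (inc H v) \<le> 2" "\<And>e. \<not> two_pendants e" "e \<in> edges H" "\<And>v. v \<in> e \<Longrightarrow> inc H v \<noteq> {e}"
    | (cycle) "\<And>v. card (inc H v) \<le> 2" "\<And>e. e \<in> edges H \<Longrightarrow> \<exists>v\<in>e. inc H v = {e}"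
  proof -
    have "card (inc H v) = 0" if "v \<notin> verts H" for v
      using inc_vert that by (metis card.empty ex_in_conv)
    then have "(\<exists>v\<in>verts H. card (inc H v) > 2) \<or> (\<forall>v. card (inc H v) \<le> 2)"
      by (metis not_le zero_le)
    then show thesis using that by metis
  qed
  then show ?thesis
  proof cases
    case high
    then show ?thesis using high_degree_case[of v] by blast
  next
    case two
    then show ?thesis using two_pendants_case[of e] by blast
  next
    case branch
    then show ?thesis using branching_edge_case[of e] by blast
  next
    case cycle
    then obtain n where n: "n \<ge> 2" "hypergraph_iso H (C_graph n)" using cycle_case[OF ne] by blast
    show ?thesis
    proof (cases "n = 2")
      case True
      then show ?thesis using n(2) C_graph_2 by simp
    next
      case False
      then have "n \<ge> 3" using n(1) by simp
      then show ?thesis using n(2) by blast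
    qed
  qed
qed

end
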